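(* Let $n,k$ be integers with $n\ge 3$ and $2\le k\le n-1$. The Archimedean spherical array $\mathscr{A}_k^{n-1}\subset\mathbb{R}^n$ is real analytic when $k$ is even and of $C^{k-1}$ smoothness when $k$ is odd.
   Context: Archimedean scaling function: $M_k=\int_0^1\frac{t^{k-1}}{\sqrt{1-t^{2k-2}}}\,dt$, and $f_k:[0,M_k]\to[0,1]$ is the function whose inverse is $f_k^{-1}(y)=\int_0^y\frac{t^{k-1}}{\sqrt{1-t^{2k-2}}}\,dt$ for $0\le y\le 1$. The Archimedean spherical array $\mathscr{A}_k^{n-1}$ is the hypersurface (unique up to scaling and translation) $$\mathscr{A}_k^{n-1}=\{(x'',x')\in B^{n-k}(M_k)\times\mathbb{R}^k:\ \|x'\|^2=[f_k(\omega(x''))]^2\}\subset\mathbb{R}^{n-k}\times\mathbb{R}^k=\mathbb{R}^n,$$ where $B^{n-k}(M_k)$ is the closed ball of radius $M_k$ in $\mathbb{R}^{n-k}$ and $\omega(x'')=\mathrm{dist}(x'',\partial B^{n-k}(M_k))$ is the distance to the boundary function on this ball. Smoothness (analytic, $C^{r}$) refers to smoothness of $\mathscr{A}_k^{n-1}$ as an embedded hypersurface of $\mathbb{R}^n$, i.e. near each of its points it is the graph, over some coordinate hyperplane, of a function of that smoothness. *)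

theory Defs
  imports "HOL-Analysis.Analysis"
begin

section \<open>Smoothness on open subsets of coordinate subspaces\<close>

text \<open>
  Throughout, \<open>B\<close> is a set of standard basis vectors and \<open>V\<close> is a relatively open subset of
  \<open>span B\<close>, regarded as a Euclidean space with coordinates indexed by \<open>B\<close>. For \<open>v \<in> V\<close>
  the derivative of \<open>g\<close> at \<open>v\<close> within \<open>V\<close> is determined on \<open>span B\<close>, so the functions
  \<open>\<lambda>v. g' v b\<close> below are the partial derivatives of \<open>g\<close>.
\<close>

primrec C_diff_on :: "'a::euclidean_space set \<Rightarrow> nat \<Rightarrow> 'a set \<Rightarrow> ('a \<Rightarrow> real) \<Rightarrow> bool" where
  "C_diff_on B 0 V g \<longleftrightarrow> continuous_on V g"
| "C_diff_on B (Suc r) V g \<longleftrightarrow>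
     (\<exists>g'. (\<forall>v\<in>V. (g has_derivative g' v) (at v within V)) \<and>
           (\<forall>b\<in>B. C_diff_on B r V (\<lambda>v. g' v b)))"

text \<open>
  Near each point \<open>g\<close> is the sum of a convergent power series in the coordinates. The
  multi-indices are the functions \<open>B \<Rightarrow> nat\<close>; convergence in the sense of \<open>has_sum\<close> is
  unconditional, hence absolute.
\<close>

definition real_analytic_on :: "'a::euclidean_space set \<Rightarrow> 'a set \<Rightarrow> ('a \<Rightarrow> real) \<Rightarrow> bool" where
  "real_analytic_on B V g \<longleftrightarrow>
     (\<forall>a\<in>V. \<exists>c :: ('a \<Rightarrow> nat) \<Rightarrow> real. \<exists>\<delta>>0. \<forall>v\<in>V. dist v a < \<delta> \<longrightarrow>
        ((\<lambda>\<alpha>. c \<alpha> * (\<Prod>b\<in>B. ((v - a) \<bullet> b) ^ \<alpha> b)) has_sum g v) (B \<rightarrow>\<^sub>E UNIV))"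

section \<open>Embedded hypersurfaces\<close>

definition coord_hyperplane :: "'a::euclidean_space \<Rightarrow> 'a set" where
  "coord_hyperplane e = {x. x \<bullet> e = 0}"

text \<open>
  \<open>P B V g\<close> is the required smoothness of \<open>g\<close> on the relatively open subset \<open>V\<close> of
  \<open>span B\<close>; note that \<open>coord_hyperplane e = span (Basis - {e})\<close> for \<open>e \<in> Basis\<close>.
\<close>

definition locally_graph ::
    "('a set \<Rightarrow> 'a set \<Rightarrow> ('a \<Rightarrow> real) \<Rightarrow> bool) \<Rightarrow> 'a::euclidean_space set \<Rightarrow> bool" where
  "locally_graph P S \<longleftrightarrow>
     (\<forall>p\<in>S. \<exists>e\<in>Basis. \<exists>U V g.
        open U \<and> p \<in> U \<and> openin (top_of_set (coord_hyperplane e)) V \<and>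
        P (Basis - {e}) V g \<and> S \<inter> U = (\<lambda>v. v + g v *\<^sub>R e) ` V)"

definition analytic_hypersurface :: "'a::euclidean_space set \<Rightarrow> bool" where
  "analytic_hypersurface S \<longleftrightarrow> locally_graph real_analytic_on S"

definition C_diff_hypersurface :: "nat \<Rightarrow> 'a::euclidean_space set \<Rightarrow> bool" where
  "C_diff_hypersurface r S \<longleftrightarrow> locally_graph (\<lambda>B. C_diff_on B r) S"

section \<open>The Archimedean spherical array\<close>

text \<open>
  The integrand is unbounded at \<open>t = 1\<close> but integrable on \<open>[0,1]\<close> for \<open>k \<ge> 2\<close>. Its junk value
  at \<open>t = 1\<close> (division by zero) does not affect the integral.
\<close>

definition arch_integral :: "nat \<Rightarrow> real \<Rightarrow> real" where
  "arch_integral k y = integral {0..y} (\<lambda>t. t ^ (k - 1) / sqrt (1 - t ^ (2 * k - 2)))"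

definition arch_M :: "nat \<Rightarrow> real" where
  "arch_M k = integral {0..1} (\<lambda>t. t ^ (k - 1) / sqrt (1 - t ^ (2 * k - 2)))"

text \<open>Only the values of \<open>arch_f k\<close> on \<open>{0..arch_M k}\<close> are meaningful.\<close>

definition arch_f :: "nat \<Rightarrow> real \<Rightarrow> real" where
  "arch_f k = the_inv_into {0..1} (arch_integral k)"

definition dist_to_boundary :: "real \<Rightarrow> 'a::euclidean_space \<Rightarrow> real" where
  "dist_to_boundary M x = infdist x (frontier (cball 0 M))"

text \<open>\<open>\<real>\<^sup>n\<close> is \<open>\<real>\<^sup>n\<^sup>-\<^sup>k \<times> \<real>\<^sup>k\<close>, with \<open>k = CARD('k)\<close> and \<open>n - k = CARD('m)\<close>.\<close>

definition arch_spherical_array :: "((real ^ 'm) \<times> (real ^ 'k)) set" where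
  "arch_spherical_array =
     {(x'', x'). x'' \<in> cball 0 (arch_M CARD('k)) \<and>
        (norm x')\<^sup>2 = (arch_f CARD('k) (dist_to_boundary (arch_M CARD('k)) x''))\<^sup>2}"

end

theory Submission
  imports Defs "HOL-Complex_Analysis.Complex_Analysis"
begin

text \<open>
  Write \<open>F\<close> for \<open>arch_integral k\<close> and \<open>M = F 1\<close>. As \<open>F\<close> is an increasing bijection of \<open>[0,1]\<close>
  onto \<open>[0,M]\<close>, the array is the set of all \<open>(x'', x')\<close> with \<open>norm x' \<le> 1\<close> and
  \<open>norm x'' = M - F (norm x')\<close> (\<open>mem_arch_spherical_array\<close>). Near each of its points it is given
  by an equation \<open>(z \<bullet> e)\<^sup>2 = Q z\<close> in which \<open>Q\<close> does not involve the coordinate along the basis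
  vector \<open>e\<close>, and then it is the graph of \<open>sqrt Q\<close> or \<open>- sqrt Q\<close>
  (\<open>locally_graph_signed_sqrt\<close>). So only the smoothness of \<open>Q\<close> matters, and there are two cases.

  Where \<open>x'' \<noteq> 0\<close>, one has \<open>norm x' < 1\<close> and the equation is
  \<open>(norm x'')\<^sup>2 = (M - F (norm x'))\<^sup>2\<close>. The integrand of \<open>F\<close> is \<open>t ^ (k - 1)\<close> times a power series
  in \<open>t ^ (2 * k - 2)\<close>. If \<open>k\<close> is even, \<open>F y\<close> is therefore a holomorphic function of \<open>y\<^sup>2\<close>
  (\<open>arch_integral_even\<close>), and \<open>(norm x')\<^sup>2\<close> is a polynomial. If \<open>k\<close> is odd, the leading term is a
  multiple of \<open>norm x' ^ k\<close>, an odd power of the norm. Differentiating \<open>F (norm x')\<close> once leaves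
  products of \<open>norm x' ^ (k - 1)\<close>, a coordinate of \<open>x' / norm x'\<close> and an analytic function; as each
  derivative of a polynomial in the coordinates of \<open>x' / norm x'\<close> costs one factor \<open>norm x'\<close>,
  this gives \<open>k - 1\<close> continuous derivatives (\<open>C_diff_on_norm_power_angular\<close>,
  \<open>C_diff_on_arch_integral_norm\<close>).

  Where \<open>x'' = 0\<close>, one has \<open>norm x' = 1\<close>, and the derivative of \<open>F\<close> blows up there. In terms of
  \<open>s = 1 - y ^ (2 * k - 2)\<close> the singularity is that of a square root:
  \<open>M - F y = sqrt s * h s\<close> with \<open>h\<close> holomorphic and \<open>h 0 \<noteq> 0\<close> (\<open>arch_integral_near_1\<close>). Hence
  \<open>(M - F y)\<^sup>2 = s * (h s)\<^sup>2\<close> is a holomorphic function of \<open>s\<close> with nonzero derivative at \<open>0\<close>. Its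
  inverse expresses \<open>s\<close>, and so \<open>y\<^sup>2\<close>, analytically through \<open>(M - F y)\<^sup>2\<close>
  (\<open>arch_profile_near_1\<close>). The equation of the array becomes
  \<open>(norm x')\<^sup>2 = G ((norm x'')\<^sup>2)\<close> with \<open>G\<close> analytic, for every \<open>k\<close>.

  Both kinds of smoothness enter only through closure under sums, products and composition with
  holomorphic functions of one variable that are evaluated on real arguments (locale
  \<open>smooth_functions\<close>). For \<open>C_diff_on\<close> this closure is the product and chain rule. For
  real analytic functions it follows from the fact that the power series about a point whose
  coefficients are summable against \<open>\<delta> ^ degree\<close> form a Banach algebra
  (\<open>majorized_expansion\<close>), into which a convergent power series of one variable may be substituted.
\<close>

section \<open>The profile integral and the equation of the array\<close>

text \<open>
  The right-hand side is the derivative of \<open>arcsin (t ^ (k - 1))\<close>, which dominates the singularity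
  of the integrand at \<open>t = 1\<close> and has a continuous primitive on \<open>[0,1]\<close>.
\<close>

lemma arch_integrand_le:
  fixes t :: real
  assumes "k \<ge> 2" "0 \<le> t" "t \<le> 1"
  shows "t ^ (k - 1) / sqrt (1 - t ^ (2 * k - 2)) \<le> real (k - 1) * t ^ (k - 2) / sqrt (1 - (t ^ (k - 1))\<^sup>2)"
proof -
  have e: "(t ^ (k - 1))\<^sup>2 = t ^ (2 * k - 2)"
    unfolding power_mult[symmetric] by (simp add: mult.commute right_diff_distrib')
  have "t ^ (k - 1) \<le> t ^ (k - 2)" using assms by (intro power_decreasing) auto
  also have "\<dots> \<le> real (k - 1) * t ^ (k - 2)"
    using assms mult_right_mono[of 1 "real (k - 1)" "t ^ (k - 2)"] by simp
  finally show ?thesis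
    unfolding e using assms by (intro divide_right_mono) (auto simp: power_le_one)
qed

lemma arch_integrand_integrable:
  assumes "k \<ge> 2"
  shows "(\<lambda>t::real. t ^ (k - 1) / sqrt (1 - t ^ (2 * k - 2))) integrable_on {0..1}"
proof (rule measurable_bounded_by_integrable_imp_integrable)
  have "(\<lambda>t::real. t ^ (k - 1) / sqrt (1 - t ^ (2 * k - 2))) \<in> borel_measurable borel"
    by measurable
  then show "(\<lambda>t::real. t ^ (k - 1) / sqrt (1 - t ^ (2 * k - 2))) \<in> borel_measurable (lebesgue_on {0..1})"
    by (intro measurable_restrict_space1 measurable_completion) simp
  have "((\<lambda>t. real (k - 1) * t ^ (k - 2) / sqrt (1 - (t ^ (k - 1))\<^sup>2)) has_integral
      (arcsin (1 ^ (k - 1)) - arcsin (0 ^ (k - 1)))) {0..1::real}"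
  proof (rule fundamental_theorem_of_calculus_interior)
    show "continuous_on {0..1::real} (\<lambda>t. arcsin (t ^ (k - 1)))"
      by (intro continuous_on_arcsin continuous_intros) (auto simp: power_le_one intro: order_trans[of _ 0])
    fix t :: real assume t: "t \<in> {0<..<1}"
    then have "t ^ (k - 1) < 1" using assms by (simp add: power_less_one_iff)
    moreover have "- 1 < t ^ (k - 1)" by (rule less_le_trans[of _ 0]) (use t in auto)
    ultimately have "((\<lambda>t. arcsin (t ^ (k - 1))) has_real_derivative
        inverse (sqrt (1 - (t ^ (k - 1))\<^sup>2)) * (real (k - 1) * t ^ (k - 1 - Suc 0))) (at t)"
      by (intro DERIV_chain2[OF DERIV_arcsin DERIV_pow])
    then have "((\<lambda>t. arcsin (t ^ (k - 1))) has_real_derivative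
        real (k - 1) * t ^ (k - 2) / sqrt (1 - (t ^ (k - 1))\<^sup>2)) (at t)"
      by (simp add: divide_inverse mult_ac numeral_2_eq_2)
    then show "((\<lambda>t. arcsin (t ^ (k - 1))) has_vector_derivative
        real (k - 1) * t ^ (k - 2) / sqrt (1 - (t ^ (k - 1))\<^sup>2)) (at t)"
      by (simp add: has_real_derivative_iff_has_vector_derivative)
  qed simp
  then show "(\<lambda>t::real. real (k - 1) * t ^ (k - 2) / sqrt (1 - (t ^ (k - 1))\<^sup>2)) integrable_on {0..1}"
    by blast
  fix t :: real assume t: "t \<in> {0..1}"
  then have "t ^ (2 * k - 2) \<le> 1" by (auto simp: power_le_one)
  then show "norm (t ^ (k - 1) / sqrt (1 - t ^ (2 * k - 2)))
      \<le> real (k - 1) * t ^ (k - 2) / sqrt (1 - (t ^ (k - 1))\<^sup>2)"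
    using arch_integrand_le[OF assms, of t] t by simp
qed simp

lemma arch_integral_0: "arch_integral k 0 = 0"
  by (simp add: arch_integral_def)

lemma arch_integral_1: "arch_integral k 1 = arch_M k"
  by (simp add: arch_integral_def arch_M_def)

lemma continuous_on_arch_integral: "k \<ge> 2 \<Longrightarrow> continuous_on {0..1} (arch_integral k)"
  using indefinite_integral_continuous_1[OF arch_integrand_integrable]
  unfolding arch_integral_def .

lemma arch_integral_has_derivative:
  fixes y :: real
  assumes "k \<ge> 2" "0 < y" "y < 1"
  shows "(arch_integral k has_real_derivative y ^ (k - 1) / sqrt (1 - y ^ (2 * k - 2))) (at y)"
proof -
  define b where "b = (1 + y) / 2"
  have b: "y < b" "b < 1" using assms by (auto simp: b_def)
  have "t ^ (2 * k - 2) < 1" if "t \<in> {0..b}" for t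
    using that b assms by (simp add: power_less_one_iff)
  then have "continuous_on {0..b} (\<lambda>t. t ^ (k - 1) / sqrt (1 - t ^ (2 * k - 2)))"
    by (auto intro!: continuous_intros simp: less_le)
  from integral_has_real_derivative[OF this, of y] assms b
  have "(arch_integral k has_real_derivative y ^ (k - 1) / sqrt (1 - y ^ (2 * k - 2))) (at y within {0..b})"
    unfolding arch_integral_def by auto
  then show ?thesis using assms b by (simp add: at_within_Icc_at)
qed

lemma arch_integral_strict_mono:
  assumes "k \<ge> 2" "0 \<le> x" "x < y" "y \<le> 1"
  shows "arch_integral k x < arch_integral k y"
proof (rule DERIV_pos_imp_increasing_open[OF \<open>x < y\<close>])
  show "continuous_on {x..y} (arch_integral k)"
    using continuous_on_arch_integral[OF assms(1)] by (rule continuous_on_subset) (use assms in auto)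
  fix t assume "x < t" "t < y"
  with assms have t: "0 < t" "t < 1" by auto
  with assms have "t ^ (2 * k - 2) < 1" by (simp add: power_less_one_iff)
  with t arch_integral_has_derivative[OF assms(1) t]
  show "\<exists>d. (arch_integral k has_real_derivative d) (at t) \<and> 0 < d"
    by (intro exI[of _ "t ^ (k - 1) / sqrt (1 - t ^ (2 * k - 2))"] conjI) auto
qed

lemma arch_integral_bounds:
  assumes "k \<ge> 2" "0 \<le> y" "y \<le> 1"
  shows "0 \<le> arch_integral k y" "arch_integral k y \<le> arch_M k"
  using arch_integral_strict_mono[OF assms(1), of 0 y] arch_integral_strict_mono[OF assms(1), of y 1] assms
    arch_integral_0[of k] arch_integral_1[of k]
  by (cases "y = 0"; cases "y = 1"; fastforce)+

lemma arch_M_pos: "k \<ge> 2 \<Longrightarrow> arch_M k > 0"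
  using arch_integral_strict_mono[of k 0 1] arch_integral_0[of k] arch_integral_1[of k] by simp

lemma arch_integral_inj: "k \<ge> 2 \<Longrightarrow> inj_on (arch_integral k) {0..1}"
  by (intro strict_mono_on_imp_inj_on strict_mono_onI) (auto intro: arch_integral_strict_mono)

lemma arch_integral_image: "k \<ge> 2 \<Longrightarrow> arch_integral k ` {0..1} = {0..arch_M k}"
proof (intro equalityI subsetI)
  fix w assume k: "k \<ge> 2" and "w \<in> {0..arch_M k}"
  then have "\<exists>y\<ge>0. y \<le> 1 \<and> arch_integral k y = w"
    by (intro IVT' continuous_on_arch_integral) (auto simp: arch_integral_0 arch_integral_1)
  then show "w \<in> arch_integral k ` {0..1}" by auto
qed (auto intro: arch_integral_bounds)

lemma arch_f_arch_integral: "k \<ge> 2 \<Longrightarrow> 0 \<le> y \<Longrightarrow> y \<le> 1 \<Longrightarrow> arch_f k (arch_integral k y) = y"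
  unfolding arch_f_def by (intro the_inv_into_f_f arch_integral_inj) auto

lemma arch_f_bounds: "k \<ge> 2 \<Longrightarrow> 0 \<le> w \<Longrightarrow> w \<le> arch_M k \<Longrightarrow> arch_f k w \<in> {0..1}"
  and arch_integral_arch_f: "k \<ge> 2 \<Longrightarrow> 0 \<le> w \<Longrightarrow> w \<le> arch_M k \<Longrightarrow> arch_integral k (arch_f k w) = w"
proof -
  assume "k \<ge> 2" "0 \<le> w" "w \<le> arch_M k"
  then have "w \<in> arch_integral k ` {0..1}" using arch_integral_image by auto
  then obtain y where "y \<in> {0..1}" "w = arch_integral k y" by auto
  with \<open>k \<ge> 2\<close> show "arch_f k w \<in> {0..1}" "arch_integral k (arch_f k w) = w"
    by (auto simp: arch_f_arch_integral)
qed

lemma dist_to_boundary_eq: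
  fixes x :: "'a::euclidean_space"
  assumes "M > 0" "norm x \<le> M"
  shows "dist_to_boundary M x = M - norm x"
proof -
  \<comment> \<open>The nearest boundary point is \<open>M *\<^sub>R u\<close>; for \<open>x = 0\<close> every direction \<open>u\<close> gives one.\<close>
  obtain u :: 'a where u: "norm u = 1" "x = norm x *\<^sub>R u"
  proof (cases "x = 0")
    case True
    obtain b :: 'a where "b \<in> Basis" using nonempty_Basis by blast
    with True that[of b] show ?thesis by simp
  next
    case False
    then show ?thesis by (intro that[of "x /\<^sub>R norm x"]) auto
  qed
  have "dist x (M *\<^sub>R u) = norm ((norm x - M) *\<^sub>R u)"
    unfolding dist_norm scaleR_left_diff_distrib using u(2) by simp
  then have "dist x (M *\<^sub>R u) = M - norm x" using assms u(1) by simp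
  moreover have "M *\<^sub>R u \<in> sphere 0 M" using assms u(1) by simp
  ultimately have "infdist x (sphere 0 M) \<le> M - norm x"
    using infdist_le[of "M *\<^sub>R u" "sphere 0 M" x] by simp
  moreover have "M - norm x \<le> infdist x (sphere 0 M)"
  proof -
    have "M - norm x \<le> dist x z" if "z \<in> sphere 0 M" for z
      using that norm_triangle_ineq2[of z x] by (simp add: dist_norm norm_minus_commute)
    moreover have ne: "sphere (0::'a) M \<noteq> {}" using \<open>M *\<^sub>R u \<in> sphere 0 M\<close> by blast
    ultimately show ?thesis
      unfolding infdist_notempty[OF ne] by (intro cINF_greatest) blast+
  qed
  ultimately show ?thesis unfolding dist_to_boundary_def by simp
qed

text \<open>
  Solving for \<open>norm x''\<close> instead of \<open>norm x'\<close> replaces \<open>arch_f\<close> by its inverse, an explicit integral.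
\<close>

lemma mem_arch_spherical_array:
  fixes x :: "real ^ 'm" and x' :: "real ^ 'k"
  assumes k: "CARD('k) \<ge> 2"
  shows "(x, x') \<in> arch_spherical_array \<longleftrightarrow>
    norm x' \<le> 1 \<and> norm x = arch_M CARD('k) - arch_integral CARD('k) (norm x')"
proof -
  let ?k = "CARD('k)"
  have "(x, x') \<in> arch_spherical_array \<longleftrightarrow>
    norm x \<le> arch_M ?k \<and> norm x' = arch_f ?k (arch_M ?k - norm x)"
  proof (cases "norm x \<le> arch_M ?k")
    case True
    then have "arch_f ?k (arch_M ?k - norm x) \<ge> 0" using arch_f_bounds[OF k] by simp
    then show ?thesis
      using True by (simp add: arch_spherical_array_def dist_to_boundary_eq[OF arch_M_pos[OF k]] power2_eq_iff_nonneg)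
  qed (simp add: arch_spherical_array_def)
  also have "\<dots> \<longleftrightarrow> norm x' \<le> 1 \<and> norm x = arch_M ?k - arch_integral ?k (norm x')"
    using arch_f_bounds[OF k, of "arch_M ?k - norm x"] arch_integral_arch_f[OF k, of "arch_M ?k - norm x"]
      arch_f_arch_integral[OF k, of "norm x'"] arch_integral_bounds[OF k, of "norm x'"]
    by auto
  finally show ?thesis .
qed

text \<open>
  A crude bound: all that is used below is that \<open>F (norm x)\<close> vanishes to second order at \<open>x = 0\<close>.
\<close>

lemma arch_integral_le_square:
  assumes k: "k \<ge> 2" and y: "0 \<le> y" "y \<le> 1 / 2"
  shows "arch_integral k y \<le> 2 * y\<^sup>2"
proof (cases "y = 0")
  case False
  then have "0 < y" using y by simp
  obtain z where z: "0 < z" "z < y" and eq: "arch_integral k y - arch_integral k 0 =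
      z ^ (k - 1) / sqrt (1 - z ^ (2 * k - 2)) * (y - 0)"
  proof (rule mvt[OF \<open>0 < y\<close>])
    show "continuous_on {0..y} (arch_integral k)"
      using continuous_on_arch_integral[OF k] by (rule continuous_on_subset) (use y in auto)
    fix t assume "0 < t" "t < y"
    then show "(arch_integral k has_derivative (*) (t ^ (k - 1) / sqrt (1 - t ^ (2 * k - 2)))) (at t)"
      using arch_integral_has_derivative[OF k, of t] y by (simp add: has_field_derivative_def)
  qed
  have "z ^ (k - 1) \<le> z ^ 1" "z ^ (2 * k - 2) \<le> z ^ 1"
    by (rule power_decreasing; use k y z in simp)+
  moreover from this have "1 / 2 \<le> sqrt (1 - z ^ (2 * k - 2))"
    using y z by (intro real_le_rsqrt) (simp add: power2_eq_square)
  ultimately have "z ^ (k - 1) / sqrt (1 - z ^ (2 * k - 2)) \<le> z / (1 / 2)"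
    using z by (intro frac_le) auto
  also have "\<dots> \<le> 2 * y" using z by simp
  finally have "z ^ (k - 1) / sqrt (1 - z ^ (2 * k - 2)) * y \<le> 2 * y * y"
    using y by (intro mult_right_mono) auto
  with eq show ?thesis by (simp add: arch_integral_0 power2_eq_square)
qed (simp add: arch_integral_0)

section \<open>Holomorphic descriptions of the profile\<close>

lemma has_real_derivative_Re_of_real:
  assumes "(h has_field_derivative d) (at (of_real x))"
  shows "((\<lambda>x. Re (h (of_real x))) has_real_derivative Re d) (at x)"
  using bounded_linear.has_vector_derivative[OF bounded_linear_Re has_vector_derivative_real_field[OF assms]]
  by (simp add: has_real_derivative_iff_has_vector_derivative)

lemma one_minus_notin_nonpos_Reals:
  fixes z :: complex
  assumes "norm z < 1"
  shows "1 - z \<notin> \<real>\<^sub>\<le>\<^sub>0"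
  using assms complex_Re_le_cmod[of z] by (auto simp: complex_nonpos_Reals_iff)

text \<open>
  In the variable \<open>s = t\<^sup>2\<close> the integral has the integrand
  \<open>s ^ (l - 1) / (2 * sqrt (1 - s ^ (k - 1)))\<close> with \<open>l = k div 2\<close>, which for even \<open>k\<close> is holomorphic
  on the unit disc; \<open>K\<close> is its primitive.
\<close>

lemma arch_integral_even:
  assumes k: "k \<ge> 2" "even k"
  obtains K where "K holomorphic_on ball 0 1"
    "\<And>y. 0 \<le> y \<Longrightarrow> y < 1 \<Longrightarrow> arch_integral k y = Re (K (of_real (y\<^sup>2)))"
proof -
  obtain l where l: "k = 2 * l" using k by (auto elim: evenE)
  define w :: "complex \<Rightarrow> complex" where "w s = s ^ (l - 1) / (2 * csqrt (1 - s ^ (k - 1)))" for s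
  have small: "norm (s ^ (k - 1)) < 1" if "s \<in> ball 0 1" for s :: complex
    using that k by (simp add: norm_power power_less_one_iff)
  have "w holomorphic_on ball 0 1"
    unfolding w_def using one_minus_notin_nonpos_Reals[OF small] small
    by (intro holomorphic_intros) fastforce+
  then obtain K0 where K0: "(K0 has_field_derivative w s) (at s within ball 0 1)" if "s \<in> ball 0 1" for s
    using holomorphic_convex_primitive'[of "ball 0 1" w] by auto
  define K where "K s = K0 s - K0 0" for s
  have K: "(K has_field_derivative w s) (at s)" if "s \<in> ball 0 1" for s
    unfolding K_def using K0[OF that] that by (auto intro!: derivative_eq_intros simp: at_within_open[of _ "ball 0 1"])
  have inball: "of_real (t\<^sup>2) \<in> ball (0::complex) 1" if "0 \<le> t" "t < 1" for t :: real
    using that by (simp add: norm_power power_less_one_iff)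
  have deriv: "((\<lambda>t. Re (K (of_real (t\<^sup>2)))) has_real_derivative Re (w (of_real (t\<^sup>2))) * (2 * t)) (at t)"
    if "0 \<le> t" "t < 1" for t
    by (rule DERIV_chain2[where f = "\<lambda>x. Re (K (of_real x))" and g = "\<lambda>t. t\<^sup>2",
          OF has_real_derivative_Re_of_real[OF K[OF inball[OF that]]]])
       (auto intro!: derivative_eq_intros)
  have "arch_integral k y = Re (K (of_real (y\<^sup>2)))" if y: "0 \<le> y" "y < 1" for y
  proof (cases "y = 0")
    case False
    then have "0 < y" using y by simp
    have "arch_integral k y - Re (K (of_real (y\<^sup>2))) = arch_integral k 0 - Re (K (of_real (0\<^sup>2)))"
    proof (rule DERIV_isconst_end[OF \<open>0 < y\<close>])
      have "continuous_on {0..y} (\<lambda>t. Re (K (of_real (t\<^sup>2))))"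
        by (rule DERIV_continuous_on[OF DERIV_subset[OF deriv]]) (use y in auto)
      then show "continuous_on {0..y} (\<lambda>t. arch_integral k t - Re (K (of_real (t\<^sup>2))))"
        using continuous_on_subset[OF continuous_on_arch_integral[OF k(1)], of "{0..y}"] y
        by (intro continuous_on_diff) auto
      fix t assume t: "0 < t" "t < y"
      have "t\<^sup>2 ^ (k - 1) < 1" using t y k by (simp add: power_less_one_iff)
      then have "csqrt (1 - of_real (t\<^sup>2) ^ (k - 1)) = of_real (sqrt (1 - (t\<^sup>2) ^ (k - 1)))"
        using of_real_sqrt[of "1 - (t\<^sup>2) ^ (k - 1)"] by simp
      then have "w (of_real (t\<^sup>2)) = of_real ((t\<^sup>2) ^ (l - 1) / (2 * sqrt (1 - (t\<^sup>2) ^ (k - 1))))"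
        unfolding w_def by simp
      moreover have "(t\<^sup>2) ^ (l - 1) * t = t ^ (k - 1)"
        using k l by (cases l) (auto simp: power_mult power_add power2_eq_square)
      moreover have "(t\<^sup>2) ^ (k - 1) = t ^ (2 * k - 2)"
        by (simp add: right_diff_distrib' flip: power_mult)
      ultimately have w_eq: "Re (w (of_real (t\<^sup>2))) * (2 * t) = t ^ (k - 1) / sqrt (1 - t ^ (2 * k - 2))"
        by simp
      have "(arch_integral k has_real_derivative t ^ (k - 1) / sqrt (1 - t ^ (2 * k - 2))) (at t)"
        using t y by (intro arch_integral_has_derivative k(1)) auto
      from DERIV_diff[OF this deriv[of t]]
      show "((\<lambda>t. arch_integral k t - Re (K (of_real (t\<^sup>2)))) has_real_derivative 0) (at t)"
        using t y unfolding w_eq by simp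
    qed
    then show ?thesis by (simp add: arch_integral_0 K_def)
  qed (simp add: arch_integral_0 K_def)
  moreover have "K holomorphic_on ball 0 1"
    using K by (intro holomorphic_onI) (auto simp: field_differentiable_def intro: has_field_derivative_at_within)
  ultimately show ?thesis using that by blast
qed

text \<open>
  The equation says that \<open>sqrt z * h z\<close> is a primitive of \<open>w z / (2 * sqrt z)\<close>. Its left-hand
  side multiplies the \<open>n\<close>-th Taylor coefficient of \<open>h\<close> by \<open>2 * n + 1\<close>, so the coefficients of \<open>h\<close> are
  obtained from those of \<open>w\<close> by division, which keeps the disc of convergence.
\<close>

lemma holomorphic_Euler_equation:
  assumes "w holomorphic_on ball 0 1"
  obtains h where "h holomorphic_on ball 0 1"
    "\<And>z. z \<in> ball 0 1 \<Longrightarrow> h z + 2 * z * deriv h z = w z"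
proof -
  define a where "a n = (deriv ^^ n) w 0 / fact n" for n
  have a: "(\<lambda>n. a n * z ^ n) sums w z" if "norm z < 1" for z
    using holomorphic_power_series[OF assms, of z] that unfolding a_def by simp
  define c where "c n = a n / of_nat (2 * n + 1)" for n
  have c: "summable (\<lambda>n. c n * z ^ n)" if z: "norm z < 1" for z
  proof (rule summable_norm_cancel, rule summable_comparison_test')
    define r where "r = (1 + norm z) / 2"
    have r: "norm z < r" "r < 1" "r > 0" using z by (auto simp: r_def intro: add_pos_nonneg)
    show "summable (\<lambda>n. norm (a n * z ^ n))"
      by (rule powser_insidea[OF sums_summable[OF a[of "of_real r"]]]) (use r in auto)
    have "norm (c n) \<le> norm (a n)" for n
    proof -
      have "norm (c n) = norm (a n) / real (2 * n + 1)"
        unfolding c_def norm_divide norm_of_nat ..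
      also have "\<dots> \<le> norm (a n) / 1" by (intro divide_left_mono) auto
      finally show ?thesis by simp
    qed
    then show "norm (norm (c n * z ^ n)) \<le> norm (a n * z ^ n)" for n
      by (simp add: norm_mult mult_right_mono)
  qed
  define h where "h z = (\<Sum>n. c n * z ^ n)" for z
  have h: "(h has_field_derivative (\<Sum>n. diffs c n * z ^ n)) (at z)" if "norm z < 1" for z
    unfolding h_def using c that by (rule termdiffs_strong')
  show ?thesis
  proof
    show "h holomorphic_on ball 0 1"
      by (intro holomorphic_onI) (auto simp: field_differentiable_def intro!: exI has_field_derivative_at_within[OF h])
    fix z :: complex assume "z \<in> ball 0 1"
    then have z: "norm z < 1" by simp
    have "(\<lambda>n. of_nat n * c n * z ^ (n - Suc 0)) sums deriv h z"
      unfolding DERIV_imp_deriv[OF h[OF z]] by (intro diffs_equiv termdiff_converges[OF z] c)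
    from sums_mult[OF this, of "2 * z"]
    have "(\<lambda>n. 2 * z * (of_nat n * c n * z ^ (n - Suc 0))) sums (2 * z * deriv h z)" .
    moreover have "(\<lambda>n. c n * z ^ n) sums h z" unfolding h_def by (rule summable_sums[OF c[OF z]])
    ultimately have "(\<lambda>n. c n * z ^ n + 2 * z * (of_nat n * c n * z ^ (n - Suc 0))) sums (h z + 2 * z * deriv h z)"
      by (rule sums_add[rotated])
    moreover have "c n * z ^ n + 2 * z * (of_nat n * c n * z ^ (n - Suc 0)) = a n * z ^ n" for n
    proof -
      have "c n * z ^ n + 2 * z * (of_nat n * c n * z ^ (n - Suc 0)) = of_nat (2 * n + 1) * c n * z ^ n"
        by (cases n) (auto simp: algebra_simps)
      moreover have "of_nat (2 * n + 1) * c n = a n"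
        unfolding c_def by (simp del: of_nat_add of_nat_Suc of_nat_mult)
      ultimately show ?thesis by simp
    qed
    ultimately show "h z + 2 * z * deriv h z = w z" using a[OF z] by (simp add: sums_unique2)
  qed
qed

text \<open>
  With \<open>s = 1 - y ^ (2 * k - 2)\<close> the differential \<open>y ^ (k - 1) / sqrt s * dy\<close> becomes
  \<open>- (1 - s) powr p / (k - 1) * ds / (2 * sqrt s)\<close> for \<open>p = 1 / (2 * (k - 1)) - 1 / 2\<close>. This has the
  form treated in \<open>holomorphic_Euler_equation\<close>, so \<open>sqrt s * h s\<close> and \<open>M - F y\<close> have the same
  derivative in \<open>y\<close>, and both vanish at \<open>y = 1\<close>.
\<close>

lemma arch_integral_near_1:
  assumes k: "k \<ge> 2"
  obtains h where "h holomorphic_on ball 0 1" "h 0 \<noteq> 0"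
    "\<And>y. 0 < y \<Longrightarrow> y \<le> 1 \<Longrightarrow> of_real (arch_M k - arch_integral k y) =
       of_real (sqrt (1 - y ^ (2 * k - 2))) * h (of_real (1 - y ^ (2 * k - 2)))"
proof -
  define q where "q = k - 1"
  have q: "q \<ge> 1" "2 * k - 2 = 2 * q" "k - 1 = q" using k by (auto simp: q_def)
  define p :: real where "p = 1 / (2 * q) - 1 / 2"
  define w :: "complex \<Rightarrow> complex" where "w z = (1 - z) powr of_real p / of_nat q" for z
  have w: "w holomorphic_on ball 0 1"
    unfolding w_def using q by (intro holomorphic_intros one_minus_notin_nonpos_Reals) auto
  obtain h where holo: "h holomorphic_on ball 0 1"
    and h: "\<And>z. z \<in> ball 0 1 \<Longrightarrow> h z + 2 * z * deriv h z = w z"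
    by (rule holomorphic_Euler_equation[OF w]) (rule that)
  have "h 0 = w 0" using h[of 0] by simp
  then have "h 0 \<noteq> 0" using q by (simp add: w_def)
  moreover have "of_real (arch_M k - arch_integral k y) =
       of_real (sqrt (1 - y ^ (2 * k - 2))) * h (of_real (1 - y ^ (2 * k - 2)))"
    if y: "0 < y" "y \<le> 1" for y
  proof (cases "y = 1")
    case False
    then have "y < 1" using y by simp
    define s :: "real \<Rightarrow> real" where "s t = 1 - t ^ (2 * q)" for t
    define D :: "real \<Rightarrow> complex" where
      "D t = of_real (sqrt (s t)) * h (of_real (s t)) + of_real (arch_integral k t)" for t
    have s: "0 \<le> s t" "s t < 1" if "t \<in> {y..1}" for t
      using that y by (auto simp: s_def power_le_one)
    have D': "(D has_vector_derivative 0) (at t)" if t: "y < t" "t < 1" for t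
    proof -
      have st: "0 < s t" using t y q by (simp add: s_def power_less_one_iff)
      let ?s' = "- (real (2 * q) * t ^ (2 * q - 1))"
      have ds: "(s has_real_derivative ?s') (at t)"
        unfolding s_def by (auto intro!: derivative_eq_intros)
      have "((\<lambda>t. sqrt (s t)) has_real_derivative inverse (sqrt (s t)) / 2 * ?s') (at t)"
        by (rule DERIV_chain2[OF DERIV_real_sqrt ds]) (rule st)
      then have 1: "((\<lambda>t. of_real (sqrt (s t)) :: complex) has_vector_derivative
          of_real (inverse (sqrt (s t)) / 2 * ?s')) (at t)"
        by (intro has_vector_derivative_of_real)
           (simp add: has_real_derivative_iff_has_vector_derivative)
      have "((\<lambda>t. of_real (s t) :: complex) has_vector_derivative of_real ?s') (at t)"
        using ds by (intro has_vector_derivative_of_real)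
           (simp add: has_real_derivative_iff_has_vector_derivative)
      moreover have "(h has_field_derivative deriv h (of_real (s t))) (at (of_real (s t)))"
        using s[of t] t by (intro holomorphic_derivI[OF holo]) auto
      ultimately have 2: "((\<lambda>t. h (of_real (s t))) has_vector_derivative
          of_real ?s' * deriv h (of_real (s t))) (at t)"
        using field_vector_diff_chain_at[of "\<lambda>t. complex_of_real (s t)" _ t h] unfolding o_def by blast
      have 3: "((\<lambda>t. of_real (arch_integral k t) :: complex) has_vector_derivative
          of_real (t ^ q / sqrt (s t))) (at t)"
        using arch_integral_has_derivative[OF k, of t] t y q
        by (intro has_vector_derivative_of_real)
           (auto simp: has_real_derivative_iff_has_vector_derivative s_def)
      have tq: "t ^ (2 * q - 1) * (t ^ (2 * q)) powr p = t ^ q"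
      proof -
        have "t ^ (2 * q - 1) * (t ^ (2 * q)) powr p = t powr (2 * q - 1) * (t powr (2 * q)) powr p"
          using t y q by (simp add: powr_realpow[symmetric] of_nat_diff)
        also have "\<dots> = t powr (2 * q - 1 + 2 * q * p)"
          by (simp add: powr_powr powr_add)
        also have "real (2 * q - 1) + real (2 * q) * p = real q"
          using q by (simp add: p_def field_simps of_nat_diff)
        finally show ?thesis using t y by (simp add: powr_realpow)
      qed
      have "w (of_real (s t)) = of_real ((t ^ (2 * q)) powr p / q)"
        using t y by (simp add: w_def s_def powr_of_real flip: of_real_power)
      then have "of_real (real q * t ^ (2 * q - 1)) * w (of_real (s t))
          = of_real (real q * t ^ (2 * q - 1) * ((t ^ (2 * q)) powr p / q))"
        by (simp only: of_real_mult)
      also have "real q * t ^ (2 * q - 1) * ((t ^ (2 * q)) powr p / q) = t ^ q"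
        using q unfolding tq[symmetric] by simp
      finally have wt: "of_real (real q * t ^ (2 * q - 1)) * w (of_real (s t)) = of_real (t ^ q)" .
      let ?H = "h (of_real (s t))" and ?H' = "deriv h (of_real (s t))" and ?r = "of_real (sqrt (s t)) :: complex"
      have r: "?r \<noteq> 0" "?r * ?r = of_real (s t)" using st by (auto simp flip: of_real_mult)
      have eq: "?H + 2 * (?r * ?r) * ?H' = w (of_real (s t))"
        using h[of "of_real (s t)"] s[of t] t r by simp
      have "?r * (of_real ?s' * ?H') + of_real (inverse (sqrt (s t)) / 2 * ?s') * ?H
          = - (of_real (real q * t ^ (2 * q - 1)) * (?H + 2 * (?r * ?r) * ?H')) / ?r"
        using r(1) by (simp add: field_simps)
      also have "\<dots> = - of_real (t ^ q) / ?r" unfolding eq wt ..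
      finally show ?thesis
        unfolding D_def using has_vector_derivative_add[OF has_vector_derivative_mult[OF 1 2] 3] by simp
    qed
    have cont: "continuous_on {y..1} D"
    proof -
      have "continuous_on {y..1} (\<lambda>t. of_real (s t) :: complex)"
        unfolding s_def by (intro continuous_intros)
      moreover have "(\<lambda>t. of_real (s t)) ` {y..1} \<subseteq> ball (0::complex) 1"
        using s by auto
      ultimately have "continuous_on {y..1} (\<lambda>t. h (of_real (s t)))"
        by (rule continuous_on_compose2[OF holomorphic_on_imp_continuous_on[OF holo]])
      then show ?thesis
        unfolding D_def using continuous_on_subset[OF continuous_on_arch_integral[OF k], of "{y..1}"] y
        by (auto intro!: continuous_intros simp: s_def)
    qed
    have "D 1 = D y"
    proof (rule has_derivative_zero_unique_strong_interval[where f = D and k = "{y, 1}" and a = y and b = 1])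
      fix t assume "t \<in> {y..1} - {y, 1}"
      then have "(D has_vector_derivative 0) (at t within {y..1})"
        using has_vector_derivative_at_within[OF D'[of t]] by simp
      then show "(D has_derivative (\<lambda>h. 0)) (at t within {y..1})"
        by (simp add: has_vector_derivative_def)
    qed (use cont y in simp_all)
    then show ?thesis
      using q by (simp add: D_def s_def arch_integral_1 algebra_simps)
  qed (use q in \<open>simp add: arch_integral_1\<close>)
  ultimately show ?thesis using that holo by blast
qed

text \<open>
  The function \<open>E s = s * (h s)\<^sup>2\<close> is locally invertible at \<open>0\<close> because \<open>h 0 \<noteq> 0\<close>. If \<open>T\<close> is its
  inverse, then \<open>T ((M - F y)\<^sup>2) = 1 - y ^ (2 * k - 2)\<close>, and a root gives \<open>y\<^sup>2\<close>.
\<close>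

lemma arch_profile_near_1:
  assumes k: "k \<ge> 2"
  obtains g \<epsilon> where "\<epsilon> > 0" "g holomorphic_on ball 0 (\<epsilon>\<^sup>2)"
    "\<And>y. 0 \<le> y \<Longrightarrow> y \<le> 1 \<Longrightarrow> arch_M k - arch_integral k y < \<epsilon> \<Longrightarrow>
       y\<^sup>2 = Re (g (of_real ((arch_M k - arch_integral k y)\<^sup>2)))"
proof -
  define q where "q = k - 1"
  have q: "q \<ge> 1" "2 * k - 2 = 2 * q" using k by (auto simp: q_def)
  obtain h where holo: "h holomorphic_on ball 0 1" "h 0 \<noteq> 0"
    and h: "\<And>y. 0 < y \<Longrightarrow> y \<le> 1 \<Longrightarrow> of_real (arch_M k - arch_integral k y) =
       of_real (sqrt (1 - y ^ (2 * k - 2))) * h (of_real (1 - y ^ (2 * k - 2)))"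
    by (rule arch_integral_near_1[OF k]) (rule that)
  define E where "E z = z * (h z)\<^sup>2" for z
  have E: "E holomorphic_on ball 0 1" unfolding E_def using holo(1) by (intro holomorphic_intros)
  have "(E has_field_derivative (h 0)\<^sup>2) (at 0)"
    unfolding E_def using holomorphic_derivI[OF holo(1), of 0]
    by (auto intro!: derivative_eq_intros)
  then have "deriv E 0 \<noteq> 0" using holo(2) by (simp add: DERIV_imp_deriv)
  then obtain \<rho> where \<rho>: "\<rho> > 0" "ball 0 \<rho> \<subseteq> ball (0::complex) 1" "inj_on E (ball 0 \<rho>)"
    by (rule has_complex_derivative_locally_injective[OF E centre_in_ball[THEN iffD2, OF zero_less_one] open_ball])
  have E\<rho>: "E holomorphic_on ball 0 \<rho>" using E \<rho>(2) by (rule holomorphic_on_subset)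
  obtain T where T: "T holomorphic_on E ` ball 0 \<rho>" "\<And>z. z \<in> ball 0 \<rho> \<Longrightarrow> T (E z) = z"
    using holomorphic_has_inverse[OF E\<rho> open_ball \<rho>(3)] by metis
  have "open (E ` ball 0 \<rho>)" by (rule open_mapping_thm3[OF E\<rho> open_ball \<rho>(3)])
  moreover have "0 \<in> E ` ball 0 \<rho>" using \<rho>(1) by (intro image_eqI[of _ _ 0]) (auto simp: E_def)
  ultimately obtain \<eta> where \<eta>: "\<eta> > 0" "ball 0 \<eta> \<subseteq> E ` ball 0 \<rho>"
    using open_contains_ball by blast
  have "\<rho> \<le> 1" using \<rho>(1,2) by (simp add: ball_subset_ball_iff)
  \<comment> \<open>The value of \<open>y\<close> at which \<open>s = \<rho> / 2\<close>; every \<open>y\<close> above it has \<open>s\<close> in the disc where \<open>T\<close> inverts \<open>E\<close>.\<close>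
  define y0 where "y0 = root (2 * q) (1 - \<rho> / 2)"
  have y0: "y0 ^ (2 * q) = 1 - \<rho> / 2" "0 \<le> y0" "y0 < 1"
    using \<open>\<rho> \<le> 1\<close> \<rho>(1) q by (auto simp: y0_def)
  define \<epsilon> where "\<epsilon> = min (sqrt \<eta>) (arch_M k - arch_integral k y0)"
  have \<epsilon>: "\<epsilon> > 0"
    using \<eta>(1) arch_integral_strict_mono[OF k y0(2,3)] by (simp add: \<epsilon>_def arch_integral_1)
  have "\<epsilon>\<^sup>2 \<le> (sqrt \<eta>)\<^sup>2" using \<epsilon> by (intro power_mono) (auto simp: \<epsilon>_def)
  then have "\<epsilon>\<^sup>2 \<le> \<eta>" using \<eta>(1) by simp
  then have sub: "ball 0 (\<epsilon>\<^sup>2) \<subseteq> E ` ball 0 \<rho>" using \<eta>(2) by (meson order_trans subset_ball)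
  define g :: "complex \<Rightarrow> complex" where "g x = (1 - T x) powr of_real (1 / q)" for x
  show ?thesis
  proof (rule that[OF \<epsilon>])
    have "1 - T x \<notin> \<real>\<^sub>\<le>\<^sub>0" if "x \<in> ball 0 (\<epsilon>\<^sup>2)" for x
    proof (rule one_minus_notin_nonpos_Reals)
      obtain z where "z \<in> ball 0 \<rho>" "x = E z" using sub \<open>x \<in> ball 0 (\<epsilon>\<^sup>2)\<close> by blast
      then show "norm (T x) < 1" using T(2) \<open>\<rho> \<le> 1\<close> by simp
    qed
    then show "g holomorphic_on ball 0 (\<epsilon>\<^sup>2)"
      unfolding g_def using holomorphic_on_subset[OF T(1) sub] by (intro holomorphic_intros)
    fix y assume y: "0 \<le> y" "y \<le> 1" and small: "arch_M k - arch_integral k y < \<epsilon>"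
    then have "arch_integral k y0 < arch_integral k y" by (simp add: \<epsilon>_def)
    then have "y0 < y"
      using arch_integral_strict_mono[OF k y(1), of y0] y0 by (cases y y0 rule: linorder_cases) auto
    define s where "s = 1 - y ^ (2 * q)"
    have "y0 ^ (2 * q) \<le> y ^ (2 * q)" using \<open>y0 < y\<close> y0 by (intro power_mono) auto
    then have s: "0 \<le> s" "s < \<rho>" using y y0 \<rho>(1) by (auto simp: s_def power_le_one)
    have "E (of_real s) = of_real ((arch_M k - arch_integral k y)\<^sup>2)"
    proof -
      have "of_real (sqrt s) * of_real (sqrt s) = (of_real s :: complex)"
        using s by (simp flip: of_real_mult)
      moreover have "of_real (arch_M k - arch_integral k y) = of_real (sqrt s) * h (of_real s)"
        using h[of y] \<open>y0 < y\<close> y0 y q by (simp add: s_def)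
      ultimately show ?thesis unfolding of_real_power E_def power2_eq_square
        by (simp add: mult_ac)
    qed
    then have "T (of_real ((arch_M k - arch_integral k y)\<^sup>2)) = of_real s"
      using T(2)[of "of_real s"] s by simp
    then have "g (of_real ((arch_M k - arch_integral k y)\<^sup>2)) = of_real (y ^ (2 * q)) powr of_real (1 / q)"
      by (simp add: g_def s_def)
    also have "\<dots> = of_real ((y ^ (2 * q)) powr (1 / q))" using y by (intro powr_of_real) simp
    also have "(y ^ (2 * q)) powr (1 / q) = y\<^sup>2"
    proof -
      have "y > 0" using \<open>y0 < y\<close> y0 by simp
      then have "(y ^ (2 * q)) powr (1 / q) = (y powr (2 * q)) powr (1 / q)"
        by (simp add: powr_realpow[symmetric])
      also have "\<dots> = y powr 2" using q by (simp add: powr_powr)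
      finally show ?thesis using \<open>y > 0\<close> by simp
    qed
    finally show "y\<^sup>2 = Re (g (of_real ((arch_M k - arch_integral k y)\<^sup>2)))" by simp
  qed
qed

section \<open>Functions stable under holomorphic composition\<close>

text \<open>
  The closure properties by which the smoothness of the graph functions is derived, for real
  analytic and for finitely differentiable functions alike. One-variable analytic functions appear
  as \<open>\<lambda>x. Re (h (of_real x))\<close> with \<open>h\<close> holomorphic; the real part spares the proof that \<open>h\<close> is real on
  the real axis.
\<close>

locale smooth_functions =
  fixes P :: "('a::euclidean_space \<Rightarrow> real) \<Rightarrow> bool" and B V :: "'a set"
  assumes const: "P (\<lambda>_. c)"
    and coord: "b \<in> B \<Longrightarrow> P (\<lambda>v. v \<bullet> b)"
    and add: "P f \<Longrightarrow> P g \<Longrightarrow> P (\<lambda>v. f v + g v)"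
    and mult: "P f \<Longrightarrow> P g \<Longrightarrow> P (\<lambda>v. f v * g v)"
    and holomorphic: "P f \<Longrightarrow> h holomorphic_on S \<Longrightarrow> open S \<Longrightarrow>
      (\<And>v. v \<in> V \<Longrightarrow> of_real (f v) \<in> S) \<Longrightarrow> P (\<lambda>v. Re (h (of_real (f v))))"
begin

lemma minus: "P f \<Longrightarrow> P g \<Longrightarrow> P (\<lambda>v. f v - g v)"
  using add[OF _ mult[OF const[of "- 1"]], of f g] by simp

lemma sum_squares:
  assumes "finite C" "C \<subseteq> B"
  shows "P (\<lambda>v. \<Sum>b\<in>C. (v \<bullet> b)\<^sup>2)"
  using assms
proof (induction C)
  case empty
  then show ?case using const[of 0] by simp
next
  case (insert b C)
  then show ?case using add[OF mult[OF coord coord], of b b "\<lambda>v. \<Sum>b\<in>C. (v \<bullet> b)\<^sup>2"]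
    by (simp add: power2_eq_square)
qed

lemma signed_sqrt:
  assumes "P f" "\<And>v. v \<in> V \<Longrightarrow> f v > 0"
  shows "P (\<lambda>v. c * Re (csqrt (of_real (f v))))"
  by (rule mult[OF const], rule holomorphic[OF assms(1) holomorphic_on_csqrt])
     (use assms(2) in \<open>auto simp: complex_nonpos_Reals_iff not_le\<close>)

end

section \<open>Real analytic functions of several variables\<close>

text \<open>
  Multi-indices are extensional outside \<open>B\<close>, so that distinct ones give distinct monomials.
\<close>

definition multi_indices :: "'a set \<Rightarrow> ('a \<Rightarrow> nat) set" where
  "multi_indices B = B \<rightarrow>\<^sub>E UNIV"

definition monomial :: "'a::euclidean_space set \<Rightarrow> ('a \<Rightarrow> nat) \<Rightarrow> 'a \<Rightarrow> real" where
  "monomial B \<alpha> x = (\<Prod>b\<in>B. (x \<bullet> b) ^ \<alpha> b)"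

text \<open>
  The bound \<open>N\<close> is on the weighted \<open>\<ell>\<^sup>1\<close> norm of the coefficients. It majorizes the series on the
  whole box of points whose coordinates in \<open>B\<close> differ from those of \<open>a\<close> by at most \<open>\<delta>\<close>. The norm is
  submultiplicative, and coordinates outside \<open>B\<close> are unconstrained.
\<close>

definition majorized_expansion ::
    "'a::euclidean_space set \<Rightarrow> 'a \<Rightarrow> real \<Rightarrow> real \<Rightarrow> ('a \<Rightarrow> real) \<Rightarrow> bool" where
  "majorized_expansion B a \<delta> N g \<longleftrightarrow>
     (\<exists>c. (\<lambda>\<alpha>. \<bar>c \<alpha>\<bar> * \<delta> ^ sum \<alpha> B) summable_on multi_indices B \<and>
          (\<Sum>\<^sub>\<infinity>\<alpha>\<in>multi_indices B. \<bar>c \<alpha>\<bar> * \<delta> ^ sum \<alpha> B) \<le> N \<and>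
          (\<forall>v. (\<forall>b\<in>B. \<bar>(v - a) \<bullet> b\<bar> \<le> \<delta>) \<longrightarrow>
             ((\<lambda>\<alpha>. c \<alpha> * monomial B \<alpha> (v - a)) has_sum g v) (multi_indices B)))"

lemma abs_monomial_le:
  assumes "finite B" "\<forall>b\<in>B. \<bar>x \<bullet> b\<bar> \<le> \<delta>"
  shows "\<bar>monomial B \<alpha> x\<bar> \<le> \<delta> ^ sum \<alpha> B"
proof -
  have "\<bar>monomial B \<alpha> x\<bar> = (\<Prod>b\<in>B. \<bar>x \<bullet> b\<bar> ^ \<alpha> b)"
    by (simp add: monomial_def abs_prod power_abs)
  also have "\<dots> \<le> (\<Prod>b\<in>B. \<delta> ^ \<alpha> b)"
    using assms by (intro prod_mono conjI power_mono) auto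
  also have "\<dots> = \<delta> ^ sum \<alpha> B" by (simp add: power_sum)
  finally show ?thesis .
qed

lemma majorized_expansion_nonneg:
  assumes "majorized_expansion B a \<delta> N g" "\<delta> > 0"
  shows "N \<ge> 0"
proof -
  obtain c where "(\<Sum>\<^sub>\<infinity>\<alpha>\<in>multi_indices B. \<bar>c \<alpha>\<bar> * \<delta> ^ sum \<alpha> B) \<le> N"
    using assms(1) unfolding majorized_expansion_def by blast
  moreover have "(\<Sum>\<^sub>\<infinity>\<alpha>\<in>multi_indices B. \<bar>c \<alpha>\<bar> * \<delta> ^ sum \<alpha> B) \<ge> 0"
    using assms(2) by (intro infsum_nonneg) auto
  ultimately show ?thesis by linarith
qed

lemma has_sum_group:
  fixes f :: "'i \<Rightarrow> real"
  assumes f: "(f has_sum s) A" and e: "e ` A \<subseteq> J"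
  shows "((\<lambda>j. infsum f {i\<in>A. e i = j}) has_sum s) J"
proof -
  let ?S = "Sigma J (\<lambda>j. {i\<in>A. e i = j})"
  have "bij_betw snd ?S A"
    using e by (intro bij_betw_byWitness[where f' = "\<lambda>i. (e i, i)"]) auto
  from has_sum_reindex_bij_betw[OF this, of f s] f have "((\<lambda>p. f (snd p)) has_sum s) ?S"
    by simp
  moreover have "((\<lambda>i. f (snd (j, i))) has_sum infsum f {i\<in>A. e i = j}) {i\<in>A. e i = j}" for j
  proof -
    have "f summable_on A" using f by (rule has_sum_imp_summable)
    then have "f summable_on {i\<in>A. e i = j}" by (rule summable_on_subset_banach) auto
    then show ?thesis by simp
  qed
  ultimately show ?thesis by (rule has_sum_SigmaD)
qed

text \<open>
  Expansions over an arbitrary index set, in which monomials may repeat, are brought to normal form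
  by collecting equal monomials. Absolute summability permits the regrouping, and the triangle
  inequality within each group keeps the bound.
\<close>

lemma majorized_expansion_indexed:
  fixes d :: "'i \<Rightarrow> real"
  assumes "finite B" "\<delta> > 0" and e: "e ` A \<subseteq> multi_indices B"
    and summable: "((\<lambda>i. \<bar>d i\<bar> * \<delta> ^ sum (e i) B) has_sum N) A"
    and g: "\<And>v. \<forall>b\<in>B. \<bar>(v - a) \<bullet> b\<bar> \<le> \<delta> \<Longrightarrow>
              ((\<lambda>i. d i * monomial B (e i) (v - a)) has_sum g v) A"
  shows "majorized_expansion B a \<delta> N g"
proof -
  define c where "c \<alpha> = infsum d {i\<in>A. e i = \<alpha>}" for \<alpha>
  have fibre: "(\<lambda>i. \<bar>d i\<bar>) summable_on {i\<in>A. e i = \<alpha>}" for \<alpha>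
  proof -
    have "(\<lambda>i. \<bar>d i\<bar> * \<delta> ^ sum (e i) B) summable_on {i\<in>A. e i = \<alpha>}"
      using has_sum_imp_summable[OF summable] by (rule summable_on_subset_banach) auto
    then have "(\<lambda>i. \<bar>d i\<bar> * \<delta> ^ sum \<alpha> B) summable_on {i\<in>A. e i = \<alpha>}"
      by (rule summable_on_cong[THEN iffD1, rotated]) auto
    then show ?thesis using \<open>\<delta> > 0\<close> by (subst (asm) summable_on_cmult_left') auto
  qed
  have norm: "((\<lambda>\<alpha>. infsum (\<lambda>i. \<bar>d i\<bar> * \<delta> ^ sum (e i) B) {i\<in>A. e i = \<alpha>}) has_sum N) (multi_indices B)"
    by (rule has_sum_group[OF summable e])
  have bound: "\<bar>c \<alpha>\<bar> * \<delta> ^ sum \<alpha> B \<le> infsum (\<lambda>i. \<bar>d i\<bar> * \<delta> ^ sum (e i) B) {i\<in>A. e i = \<alpha>}" for \<alpha>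
  proof -
    have "\<bar>c \<alpha>\<bar> \<le> infsum (\<lambda>i. \<bar>d i\<bar>) {i\<in>A. e i = \<alpha>}"
      unfolding c_def using norm_infsum_bound[of d "{i\<in>A. e i = \<alpha>}"] fibre by simp
    then have "\<bar>c \<alpha>\<bar> * \<delta> ^ sum \<alpha> B \<le> infsum (\<lambda>i. \<bar>d i\<bar>) {i\<in>A. e i = \<alpha>} * \<delta> ^ sum \<alpha> B"
      using \<open>\<delta> > 0\<close> by (intro mult_right_mono) auto
    also have "\<dots> = infsum (\<lambda>i. \<bar>d i\<bar> * \<delta> ^ sum \<alpha> B) {i\<in>A. e i = \<alpha>}"
      by (rule infsum_cmult_left'[symmetric])
    also have "\<dots> = infsum (\<lambda>i. \<bar>d i\<bar> * \<delta> ^ sum (e i) B) {i\<in>A. e i = \<alpha>}"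
      by (rule infsum_cong) auto
    finally show ?thesis .
  qed
  have "(\<lambda>\<alpha>. \<bar>c \<alpha>\<bar> * \<delta> ^ sum \<alpha> B) summable_on multi_indices B"
    using \<open>\<delta> > 0\<close> by (intro summable_on_comparison_test[OF has_sum_imp_summable[OF norm]] bound) auto
  moreover from this have "(\<Sum>\<^sub>\<infinity>\<alpha>\<in>multi_indices B. \<bar>c \<alpha>\<bar> * \<delta> ^ sum \<alpha> B) \<le> N"
    by (intro has_sum_mono[OF has_sum_infsum norm] bound)
  moreover have "((\<lambda>\<alpha>. c \<alpha> * monomial B \<alpha> (v - a)) has_sum g v) (multi_indices B)"
    if "\<forall>b\<in>B. \<bar>(v - a) \<bullet> b\<bar> \<le> \<delta>" for v
  proof -
    have "((\<lambda>\<alpha>. infsum (\<lambda>i. d i * monomial B (e i) (v - a)) {i\<in>A. e i = \<alpha>}) has_sum g v) (multi_indices B)"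
      by (rule has_sum_group[OF g[OF that] e])
    moreover have "infsum (\<lambda>i. d i * monomial B (e i) (v - a)) {i\<in>A. e i = \<alpha>}
        = c \<alpha> * monomial B \<alpha> (v - a)" for \<alpha>
      unfolding c_def infsum_cmult_left'[symmetric] by (rule infsum_cong) auto
    ultimately show ?thesis by simp
  qed
  ultimately show ?thesis
    unfolding majorized_expansion_def by (intro exI[of _ c] conjI allI impI)
qed

lemma majorized_expansionE:
  assumes "majorized_expansion B a \<delta> N g" "finite B" "\<delta> > 0"
  obtains c N' where "((\<lambda>\<alpha>. \<bar>c \<alpha>\<bar> * \<delta> ^ sum \<alpha> B) has_sum N') (multi_indices B)" "0 \<le> N'" "N' \<le> N"
    "\<forall>v. (\<forall>b\<in>B. \<bar>(v - a) \<bullet> b\<bar> \<le> \<delta>) \<longrightarrow>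
       ((\<lambda>\<alpha>. c \<alpha> * monomial B \<alpha> (v - a)) has_sum g v) (multi_indices B)"
proof -
  obtain c where c: "(\<lambda>\<alpha>. \<bar>c \<alpha>\<bar> * \<delta> ^ sum \<alpha> B) summable_on multi_indices B"
     "(\<Sum>\<^sub>\<infinity>\<alpha>\<in>multi_indices B. \<bar>c \<alpha>\<bar> * \<delta> ^ sum \<alpha> B) \<le> N"
     "\<forall>v. (\<forall>b\<in>B. \<bar>(v - a) \<bullet> b\<bar> \<le> \<delta>) \<longrightarrow>
             ((\<lambda>\<alpha>. c \<alpha> * monomial B \<alpha> (v - a)) has_sum g v) (multi_indices B)"
    using assms(1) unfolding majorized_expansion_def by blast
  have "(\<Sum>\<^sub>\<infinity>\<alpha>\<in>multi_indices B. \<bar>c \<alpha>\<bar> * \<delta> ^ sum \<alpha> B) \<ge> 0"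
    using assms(3) by (intro infsum_nonneg) auto
  then show ?thesis by (rule that[OF has_sum_infsum[OF c(1)] _ c(2,3)])
qed

lemma majorized_expansion_mono:
  "majorized_expansion B a \<delta> N g \<Longrightarrow> N \<le> N' \<Longrightarrow> majorized_expansion B a \<delta> N' g"
  unfolding majorized_expansion_def by (elim exE conjE, intro exI conjI, assumption, erule order_trans)

lemma majorized_expansion_cong:
  assumes "majorized_expansion B a \<delta> N g"
    and "\<And>v. \<forall>b\<in>B. \<bar>(v - a) \<bullet> b\<bar> \<le> \<delta> \<Longrightarrow> g v = g' v"
  shows "majorized_expansion B a \<delta> N g'"
proof -
  obtain c where "(\<lambda>\<alpha>. \<bar>c \<alpha>\<bar> * \<delta> ^ sum \<alpha> B) summable_on multi_indices B"
     "(\<Sum>\<^sub>\<infinity>\<alpha>\<in>multi_indices B. \<bar>c \<alpha>\<bar> * \<delta> ^ sum \<alpha> B) \<le> N"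
     "\<forall>v. (\<forall>b\<in>B. \<bar>(v - a) \<bullet> b\<bar> \<le> \<delta>) \<longrightarrow>
             ((\<lambda>\<alpha>. c \<alpha> * monomial B \<alpha> (v - a)) has_sum g v) (multi_indices B)"
    using assms(1) unfolding majorized_expansion_def by blast
  then show ?thesis
    unfolding majorized_expansion_def using assms(2) by (intro exI[of _ c]) simp
qed

lemma majorized_expansion_single:
  assumes "finite B" "\<delta> > 0" "\<beta> \<in> multi_indices B"
  shows "majorized_expansion B a \<delta> (\<bar>c\<bar> * \<delta> ^ sum \<beta> B) (\<lambda>v. c * monomial B \<beta> (v - a))"
proof (rule majorized_expansion_indexed[where A = "{()}" and e = "\<lambda>_. \<beta>" and d = "\<lambda>_. c"])
  show "((\<lambda>_. \<bar>c\<bar> * \<delta> ^ sum \<beta> B) has_sum \<bar>c\<bar> * \<delta> ^ sum \<beta> B) {()}"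
    by (simp only: has_sum_finite_iff[OF finite.insertI[OF finite.emptyI]]) simp
  show "((\<lambda>_. c * monomial B \<beta> (v - a)) has_sum c * monomial B \<beta> (v - a)) {()}" for v
    by (simp only: has_sum_finite_iff[OF finite.insertI[OF finite.emptyI]]) simp
qed (use assms in simp_all)

lemma majorized_expansion_const:
  assumes "finite B" "\<delta> > 0"
  shows "majorized_expansion B a \<delta> \<bar>c\<bar> (\<lambda>v. c)"
  using majorized_expansion_single[OF assms, of "\<lambda>b\<in>B. 0" a c]
  by (simp add: multi_indices_def monomial_def)

lemma majorized_expansion_coord:
  assumes "finite B" "\<delta> > 0" "b \<in> B"
  shows "majorized_expansion B a \<delta> \<delta> (\<lambda>v. (v - a) \<bullet> b)"
proof -
  let ?\<beta> = "\<lambda>i\<in>B. if i = b then 1 else 0 :: nat"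
  have "monomial B ?\<beta> x = x \<bullet> b" for x
  proof -
    have "monomial B ?\<beta> x = (\<Prod>i\<in>B. if i = b then x \<bullet> b else 1)"
      unfolding monomial_def by (rule prod.cong) auto
    then show ?thesis using assms by simp
  qed
  moreover have "sum ?\<beta> B = 1"
  proof -
    have "sum ?\<beta> B = (\<Sum>i\<in>B. if i = b then 1 else 0)" by (rule sum.cong) auto
    then show ?thesis using assms by simp
  qed
  ultimately show ?thesis
    using majorized_expansion_single[OF assms(1,2), of ?\<beta> a 1]
    by (simp add: multi_indices_def)
qed

text \<open>
  The product is a series over pairs of multi-indices. Degrees add, so the weights \<open>\<delta> ^ degree\<close>
  multiply, and the sum of the absolute values over all pairs is the product of the two norms.
\<close>

lemma majorized_expansion_mult:
  assumes B: "finite B" "\<delta> > 0"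
    and "majorized_expansion B a \<delta> M f" "majorized_expansion B a \<delta> N g"
  shows "majorized_expansion B a \<delta> (M * N) (\<lambda>v. f v * g v)"
proof -
  obtain c M' where c: "((\<lambda>\<alpha>. \<bar>c \<alpha>\<bar> * \<delta> ^ sum \<alpha> B) has_sum M') (multi_indices B)" "0 \<le> M'" "M' \<le> M"
    "\<forall>v. (\<forall>b\<in>B. \<bar>(v - a) \<bullet> b\<bar> \<le> \<delta>) \<longrightarrow>
       ((\<lambda>\<alpha>. c \<alpha> * monomial B \<alpha> (v - a)) has_sum f v) (multi_indices B)"
    by (rule majorized_expansionE[OF assms(3) B])
  obtain d N' where d: "((\<lambda>\<alpha>. \<bar>d \<alpha>\<bar> * \<delta> ^ sum \<alpha> B) has_sum N') (multi_indices B)" "0 \<le> N'" "N' \<le> N"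
    "\<forall>v. (\<forall>b\<in>B. \<bar>(v - a) \<bullet> b\<bar> \<le> \<delta>) \<longrightarrow>
       ((\<lambda>\<alpha>. d \<alpha> * monomial B \<alpha> (v - a)) has_sum g v) (multi_indices B)"
    by (rule majorized_expansionE[OF assms(4) B])
  let ?I = "multi_indices B"
  let ?e = "\<lambda>(\<alpha>, \<beta>). \<lambda>b\<in>B. \<alpha> b + \<beta> b :: nat"
  let ?w = "\<lambda>(\<alpha>, \<beta>). c \<alpha> * d \<beta>"
  have deg: "sum (\<lambda>b\<in>B. \<alpha> b + \<beta> b) B = sum \<alpha> B + sum \<beta> B" for \<alpha> \<beta>
  proof -
    have "sum (\<lambda>b\<in>B. \<alpha> b + \<beta> b) B = (\<Sum>b\<in>B. \<alpha> b + \<beta> b)" by (rule sum.cong) auto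
    then show ?thesis by (simp add: sum.distrib)
  qed
  have mon: "monomial B (\<lambda>b\<in>B. \<alpha> b + \<beta> b) x = monomial B \<alpha> x * monomial B \<beta> x" for \<alpha> \<beta> x
  proof -
    have "monomial B (\<lambda>b\<in>B. \<alpha> b + \<beta> b) x = (\<Prod>b\<in>B. (x \<bullet> b) ^ (\<alpha> b + \<beta> b))"
      unfolding monomial_def by (rule prod.cong) auto
    then show ?thesis by (simp add: monomial_def power_add prod.distrib)
  qed
  have norm_term: "\<bar>?w (\<alpha>, \<beta>)\<bar> * \<delta> ^ sum (?e (\<alpha>, \<beta>)) B
      = \<bar>c \<alpha>\<bar> * \<delta> ^ sum \<alpha> B * (\<bar>d \<beta>\<bar> * \<delta> ^ sum \<beta> B)" for \<alpha> \<beta>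
    unfolding prod.case deg power_add abs_mult by (rule mult.assoc[THEN trans]) (simp add: mult_ac)
  have value_term: "?w (\<alpha>, \<beta>) * monomial B (?e (\<alpha>, \<beta>)) x
      = c \<alpha> * monomial B \<alpha> x * (d \<beta> * monomial B \<beta> x)" for \<alpha> \<beta> x
    unfolding prod.case mon by (simp add: mult_ac)
  have norms: "((\<lambda>p. \<bar>?w p\<bar> * \<delta> ^ sum (?e p) B) has_sum M' * N') (?I \<times> ?I)"
  proof (rule has_sum_SigmaI)
    show "((\<lambda>\<beta>. \<bar>?w (\<alpha>, \<beta>)\<bar> * \<delta> ^ sum (?e (\<alpha>, \<beta>)) B) has_sum \<bar>c \<alpha>\<bar> * \<delta> ^ sum \<alpha> B * N') ?I" for \<alpha>
      unfolding norm_term by (rule has_sum_cmult_right[OF d(1)])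
    show "((\<lambda>\<alpha>. \<bar>c \<alpha>\<bar> * \<delta> ^ sum \<alpha> B * N') has_sum M' * N') ?I"
      by (rule has_sum_cmult_left[OF c(1)])
    show "(\<lambda>p. \<bar>?w p\<bar> * \<delta> ^ sum (?e p) B) summable_on ?I \<times> ?I"
    proof (rule summable_on_SigmaI)
      show "((\<lambda>\<beta>. \<bar>?w (\<alpha>, \<beta>)\<bar> * \<delta> ^ sum (?e (\<alpha>, \<beta>)) B) has_sum \<bar>c \<alpha>\<bar> * \<delta> ^ sum \<alpha> B * N') ?I" for \<alpha>
        unfolding norm_term by (rule has_sum_cmult_right[OF d(1)])
      show "(\<lambda>\<alpha>. \<bar>c \<alpha>\<bar> * \<delta> ^ sum \<alpha> B * N') summable_on ?I"
        using has_sum_cmult_left[OF c(1)] by (rule has_sum_imp_summable)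
    qed (use B in simp)
  qed
  have "majorized_expansion B a \<delta> (M' * N') (\<lambda>v. f v * g v)"
  proof (rule majorized_expansion_indexed[OF B _ norms])
    show "?e ` (?I \<times> ?I) \<subseteq> ?I" by (auto simp: multi_indices_def)
    fix v assume v: "\<forall>b\<in>B. \<bar>(v - a) \<bullet> b\<bar> \<le> \<delta>"
    show "((\<lambda>p. ?w p * monomial B (?e p) (v - a)) has_sum f v * g v) (?I \<times> ?I)"
    proof (rule has_sum_SigmaI)
      show "((\<lambda>\<beta>. ?w (\<alpha>, \<beta>) * monomial B (?e (\<alpha>, \<beta>)) (v - a)) has_sum c \<alpha> * monomial B \<alpha> (v - a) * g v) ?I" for \<alpha>
        unfolding value_term by (rule has_sum_cmult_right[OF d(4)[THEN spec, THEN mp, OF v]])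
      show "((\<lambda>\<alpha>. c \<alpha> * monomial B \<alpha> (v - a) * g v) has_sum f v * g v) ?I"
        by (rule has_sum_cmult_left[OF c(4)[THEN spec, THEN mp, OF v]])
      show "(\<lambda>p. ?w p * monomial B (?e p) (v - a)) summable_on ?I \<times> ?I"
      proof (rule summable_on_iff_abs_summable_on_real[THEN iffD2], rule summable_on_comparison_test[OF has_sum_imp_summable[OF norms]])
        fix p
        show "norm (?w p * monomial B (?e p) (v - a)) \<le> \<bar>?w p\<bar> * \<delta> ^ sum (?e p) B"
          unfolding real_norm_def abs_mult[of "?w p"]
          by (intro mult_left_mono abs_monomial_le B v abs_ge_zero)
      qed simp
    qed
  qed
  moreover have "M' * N' \<le> M * N" using c(2,3) d(2,3) by (intro mult_mono) simp_all
  ultimately show ?thesis by (rule majorized_expansion_mono)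
qed

lemma majorized_expansion_power:
  assumes B: "finite B" "\<delta> > 0" and "majorized_expansion B a \<delta> N g"
  shows "majorized_expansion B a \<delta> (N ^ n) (\<lambda>v. g v ^ n)"
proof (induction n)
  case 0
  then show ?case using majorized_expansion_const[OF B, of a 1] by simp
next
  case (Suc n)
  then show ?case using majorized_expansion_mult[OF B assms(3) Suc] by simp
qed

text \<open>
  Substitution into a power series needs infinite sums. Summability of the norms makes the double
  series over \<open>n\<close> and \<open>\<alpha>\<close> absolutely summable, so that it may be summed over \<open>n\<close> first.
\<close>

lemma majorized_expansion_suminf:
  assumes B: "finite B" "\<delta> > 0"
    and g: "\<And>n. majorized_expansion B a \<delta> (N n) (g n)" and N: "summable N"
  shows "majorized_expansion B a \<delta> (suminf N) (\<lambda>v. \<Sum>n. g n v)"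
proof -
  let ?I = "multi_indices B"
  have "\<exists>p. ((\<lambda>\<alpha>. \<bar>fst p \<alpha>\<bar> * \<delta> ^ sum \<alpha> B) has_sum snd p) ?I \<and> 0 \<le> snd p \<and> snd p \<le> N n \<and>
    (\<forall>v. (\<forall>b\<in>B. \<bar>(v - a) \<bullet> b\<bar> \<le> \<delta>) \<longrightarrow>
       ((\<lambda>\<alpha>. fst p \<alpha> * monomial B \<alpha> (v - a)) has_sum g n v) ?I)" (is "\<exists>p. ?R n p") for n
  proof -
    obtain c N' where "((\<lambda>\<alpha>. \<bar>c \<alpha>\<bar> * \<delta> ^ sum \<alpha> B) has_sum N') ?I" "0 \<le> N'" "N' \<le> N n"
      "\<forall>v. (\<forall>b\<in>B. \<bar>(v - a) \<bullet> b\<bar> \<le> \<delta>) \<longrightarrow>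
         ((\<lambda>\<alpha>. c \<alpha> * monomial B \<alpha> (v - a)) has_sum g n v) ?I"
      by (rule majorized_expansionE[OF g[of n] B])
    then have "?R n (c, N')" by simp
    then show ?thesis ..
  qed
  then have "\<exists>p. \<forall>n. ?R n (p n)" by (intro choice allI)
  then obtain p where p: "\<And>n. ?R n (p n)" by (elim exE) (rule that, erule spec)
  define c where "c n = fst (p n)" for n
  define N' where "N' n = snd (p n)" for n
  have c: "((\<lambda>\<alpha>. \<bar>c n \<alpha>\<bar> * \<delta> ^ sum \<alpha> B) has_sum N' n) ?I" "0 \<le> N' n" "N' n \<le> N n" for n
    using p[of n] unfolding c_def N'_def by blast+
  have c4: "((\<lambda>\<alpha>. c n \<alpha> * monomial B \<alpha> (v - a)) has_sum g n v) ?I"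
    if "\<forall>b\<in>B. \<bar>(v - a) \<bullet> b\<bar> \<le> \<delta>" for n v
    using p[of n] that unfolding c_def by blast
  have N': "summable N'" using c by (intro summable_comparison_test'[OF N, of 0]) auto
  then have N'_sum: "(N' has_sum suminf N') UNIV"
    using c by (intro norm_summable_imp_has_sum) (auto simp: summable_sums)
  have norms: "((\<lambda>p. \<bar>case_prod c p\<bar> * \<delta> ^ sum (snd p) B) has_sum suminf N') (UNIV \<times> ?I)"
  proof (rule has_sum_SigmaI[OF _ N'_sum])
    show "(\<lambda>p. \<bar>case_prod c p\<bar> * \<delta> ^ sum (snd p) B) summable_on UNIV \<times> ?I"
      by (rule summable_on_SigmaI[OF _ has_sum_imp_summable[OF N'_sum]]) (use c B in auto)
  qed (use c in auto)
  have "majorized_expansion B a \<delta> (suminf N') (\<lambda>v. \<Sum>n. g n v)"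
  proof (rule majorized_expansion_indexed[OF B _ norms])
    fix v assume v: "\<forall>b\<in>B. \<bar>(v - a) \<bullet> b\<bar> \<le> \<delta>"
    let ?t = "\<lambda>p. case_prod c p * monomial B (snd p) (v - a)"
    have "?t summable_on UNIV \<times> ?I"
    proof (rule summable_on_iff_abs_summable_on_real[THEN iffD2], rule summable_on_comparison_test[OF has_sum_imp_summable[OF norms]])
      fix p
      show "norm (?t p) \<le> \<bar>case_prod c p\<bar> * \<delta> ^ sum (snd p) B"
        unfolding real_norm_def abs_mult by (intro mult_left_mono abs_monomial_le B v) auto
    qed auto
    then obtain s where s: "(?t has_sum s) (UNIV \<times> ?I)"
      unfolding summable_on_def by blast
    have "((\<lambda>n. g n v) has_sum s) UNIV"
      by (rule has_sum_SigmaD[OF s]) (use c4 v in auto)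
    then have "s = (\<Sum>n. g n v)" by (simp add: has_sum_imp_sums sums_unique)
    with s show "(?t has_sum (\<Sum>n. g n v)) (UNIV \<times> ?I)" by simp
  qed auto
  moreover have "suminf N' \<le> suminf N" using c by (intro suminf_le N N') auto
  ultimately show ?thesis by (rule majorized_expansion_mono)
qed

lemma majorized_expansion_add:
  assumes B: "finite B" "\<delta> > 0"
    and "majorized_expansion B a \<delta> M f" "majorized_expansion B a \<delta> N g"
  shows "majorized_expansion B a \<delta> (M + N) (\<lambda>v. f v + g v)"
proof -
  obtain c M' where c: "((\<lambda>\<alpha>. \<bar>c \<alpha>\<bar> * \<delta> ^ sum \<alpha> B) has_sum M') (multi_indices B)" "0 \<le> M'" "M' \<le> M"
    "\<forall>v. (\<forall>b\<in>B. \<bar>(v - a) \<bullet> b\<bar> \<le> \<delta>) \<longrightarrow>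
       ((\<lambda>\<alpha>. c \<alpha> * monomial B \<alpha> (v - a)) has_sum f v) (multi_indices B)"
    by (rule majorized_expansionE[OF assms(3) B])
  obtain d N' where d: "((\<lambda>\<alpha>. \<bar>d \<alpha>\<bar> * \<delta> ^ sum \<alpha> B) has_sum N') (multi_indices B)" "0 \<le> N'" "N' \<le> N"
    "\<forall>v. (\<forall>b\<in>B. \<bar>(v - a) \<bullet> b\<bar> \<le> \<delta>) \<longrightarrow>
       ((\<lambda>\<alpha>. d \<alpha> * monomial B \<alpha> (v - a)) has_sum g v) (multi_indices B)"
    by (rule majorized_expansionE[OF assms(4) B])
  have sum: "((\<lambda>\<alpha>. \<bar>c \<alpha>\<bar> * \<delta> ^ sum \<alpha> B + \<bar>d \<alpha>\<bar> * \<delta> ^ sum \<alpha> B) has_sum M' + N') (multi_indices B)"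
    by (rule has_sum_add[OF c(1) d(1)])
  have le: "\<bar>c \<alpha> + d \<alpha>\<bar> * \<delta> ^ sum \<alpha> B \<le> \<bar>c \<alpha>\<bar> * \<delta> ^ sum \<alpha> B + \<bar>d \<alpha>\<bar> * \<delta> ^ sum \<alpha> B" for \<alpha>
    unfolding distrib_right[symmetric] using B by (intro mult_right_mono) auto
  have 1: "(\<lambda>\<alpha>. \<bar>c \<alpha> + d \<alpha>\<bar> * \<delta> ^ sum \<alpha> B) summable_on multi_indices B"
    using B by (intro summable_on_comparison_test[OF has_sum_imp_summable[OF sum]] le) auto
  then have 2: "(\<Sum>\<^sub>\<infinity>\<alpha>\<in>multi_indices B. \<bar>c \<alpha> + d \<alpha>\<bar> * \<delta> ^ sum \<alpha> B) \<le> M' + N'"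
    by (intro has_sum_mono[OF has_sum_infsum sum] le)
  have 3: "((\<lambda>\<alpha>. (c \<alpha> + d \<alpha>) * monomial B \<alpha> (v - a)) has_sum f v + g v) (multi_indices B)"
    if "\<forall>b\<in>B. \<bar>(v - a) \<bullet> b\<bar> \<le> \<delta>" for v
    using has_sum_add[OF c(4)[THEN spec, THEN mp, OF that] d(4)[THEN spec, THEN mp, OF that]] by (simp add: distrib_right)
  have "majorized_expansion B a \<delta> (M' + N') (\<lambda>v. f v + g v)"
    unfolding majorized_expansion_def by (intro exI[of _ "\<lambda>\<alpha>. c \<alpha> + d \<alpha>"] conjI allI impI 1 2 3)
  then show ?thesis by (rule majorized_expansion_mono) (use c d in auto)
qed

text \<open>
  Shrinking the box by the factor \<open>t\<close> multiplies every term of positive degree by at most \<open>t\<close>, and the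
  constant term is \<open>g a\<close>. A function that vanishes at \<open>a\<close> therefore acquires an arbitrarily small
  norm, which is what substitution into a power series requires.
\<close>

lemma majorized_expansion_shrink:
  assumes B: "finite B" "\<delta> > 0" and "majorized_expansion B a \<delta> N g" and t: "0 < t" "t \<le> 1"
  shows "majorized_expansion B a (t * \<delta>) (\<bar>g a\<bar> + t * N) g"
proof -
  let ?I = "multi_indices B"
  obtain c N' where c: "((\<lambda>\<alpha>. \<bar>c \<alpha>\<bar> * \<delta> ^ sum \<alpha> B) has_sum N') ?I" "0 \<le> N'" "N' \<le> N"
    "\<forall>v. (\<forall>b\<in>B. \<bar>(v - a) \<bullet> b\<bar> \<le> \<delta>) \<longrightarrow>
       ((\<lambda>\<alpha>. c \<alpha> * monomial B \<alpha> (v - a)) has_sum g v) ?I"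
    by (rule majorized_expansionE[OF assms(3) B])
  let ?o = "\<lambda>b\<in>B. 0 :: nat"
  have o: "?o \<in> ?I" by (auto simp: multi_indices_def)
  have pos: "sum \<alpha> B > 0" if "\<alpha> \<in> ?I" "\<alpha> \<noteq> ?o" for \<alpha>
  proof (rule ccontr)
    assume "\<not> ?thesis"
    then have "\<forall>b\<in>B. \<alpha> b = 0" using B by simp
    then have "\<alpha> = ?o" using that(1)
      by (intro ext) (auto simp: multi_indices_def PiE_def extensional_def)
    with that(2) show False by simp
  qed
  have "((\<lambda>\<alpha>. c \<alpha> * monomial B \<alpha> (a - a)) has_sum c ?o) ?I"
  proof -
    have "((\<lambda>\<alpha>. c \<alpha> * monomial B \<alpha> (a - a)) has_sum c ?o) {?o}"
      by (simp add: has_sum_finite_iff monomial_def)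
    then show ?thesis
    proof (rule has_sum_cong_neutral[THEN iffD1, rotated -1])
      fix \<alpha> assume "\<alpha> \<in> ?I - {?o}"
      then have "\<exists>b\<in>B. \<alpha> b \<noteq> 0" using pos[of \<alpha>] by (auto intro: ccontr)
      then show "c \<alpha> * monomial B \<alpha> (a - a) = 0"
        using B by (auto simp: monomial_def)
    qed (use o in auto)
  qed
  moreover have "((\<lambda>\<alpha>. c \<alpha> * monomial B \<alpha> (a - a)) has_sum g a) ?I"
    using B by (intro c(4)[THEN spec, THEN mp]) auto
  ultimately have co: "c ?o = g a" by (rule has_sum_unique)
  have le: "\<bar>c \<alpha>\<bar> * (t * \<delta>) ^ sum \<alpha> B \<le> (if \<alpha> = ?o then \<bar>g a\<bar> else 0) + t * (\<bar>c \<alpha>\<bar> * \<delta> ^ sum \<alpha> B)"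
    if "\<alpha> \<in> ?I" for \<alpha>
  proof (cases "\<alpha> = ?o")
    case True
    then show ?thesis using co B t by simp
  next
    case False
    then have "t ^ sum \<alpha> B \<le> t ^ 1" using pos[OF that] t by (intro power_decreasing) auto
    then have "t ^ sum \<alpha> B * (\<bar>c \<alpha>\<bar> * \<delta> ^ sum \<alpha> B) \<le> t * (\<bar>c \<alpha>\<bar> * \<delta> ^ sum \<alpha> B)"
      using B by (intro mult_right_mono) auto
    then show ?thesis using False by (simp add: power_mult_distrib mult_ac)
  qed
  have "((\<lambda>\<alpha>. if \<alpha> = ?o then \<bar>g a\<bar> else 0) has_sum \<bar>g a\<bar>) ?I"
    using has_sum_cong_neutral[of "{?o}" ?I "\<lambda>\<alpha>. if \<alpha> = ?o then \<bar>g a\<bar> else 0" "\<lambda>\<alpha>. if \<alpha> = ?o then \<bar>g a\<bar> else 0" "\<bar>g a\<bar>"] o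
    by (simp add: has_sum_finite_iff insert_absorb)
  then have sum: "((\<lambda>\<alpha>. (if \<alpha> = ?o then \<bar>g a\<bar> else 0) + t * (\<bar>c \<alpha>\<bar> * \<delta> ^ sum \<alpha> B)) has_sum
      (\<bar>g a\<bar> + t * N')) ?I"
    by (rule has_sum_add[OF _ has_sum_cmult_right[OF c(1)]])
  have 1: "(\<lambda>\<alpha>. \<bar>c \<alpha>\<bar> * (t * \<delta>) ^ sum \<alpha> B) summable_on ?I"
    using B t by (intro summable_on_comparison_test[OF has_sum_imp_summable[OF sum]] le) auto
  then have 2: "(\<Sum>\<^sub>\<infinity>\<alpha>\<in>?I. \<bar>c \<alpha>\<bar> * (t * \<delta>) ^ sum \<alpha> B) \<le> \<bar>g a\<bar> + t * N'"
    by (intro has_sum_mono[OF has_sum_infsum sum] le)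
  have 3: "((\<lambda>\<alpha>. c \<alpha> * monomial B \<alpha> (v - a)) has_sum g v) ?I"
    if v: "\<forall>b\<in>B. \<bar>(v - a) \<bullet> b\<bar> \<le> t * \<delta>" for v
  proof (rule c(4)[THEN spec, THEN mp], rule ballI)
    have "t * \<delta> \<le> 1 * \<delta>" using B t by (intro mult_right_mono) auto
    then show "\<bar>(v - a) \<bullet> b\<bar> \<le> \<delta>" if "b \<in> B" for b using v that by fastforce
  qed
  have "majorized_expansion B a (t * \<delta>) (\<bar>g a\<bar> + t * N') g"
    unfolding majorized_expansion_def by (intro exI[of _ c] conjI allI impI 1 2 3)
  then show ?thesis by (rule majorized_expansion_mono) (use c t in auto)
qed

lemma majorized_expansion_bound:
  assumes B: "finite B" "\<delta> > 0" and g: "majorized_expansion B a \<delta> N g"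
    and v: "\<forall>b\<in>B. \<bar>(v - a) \<bullet> b\<bar> \<le> \<delta>"
  shows "\<bar>g v\<bar> \<le> N"
proof -
  obtain c N' where c: "((\<lambda>\<alpha>. \<bar>c \<alpha>\<bar> * \<delta> ^ sum \<alpha> B) has_sum N') (multi_indices B)" "0 \<le> N'" "N' \<le> N"
    "\<forall>v. (\<forall>b\<in>B. \<bar>(v - a) \<bullet> b\<bar> \<le> \<delta>) \<longrightarrow>
       ((\<lambda>\<alpha>. c \<alpha> * monomial B \<alpha> (v - a)) has_sum g v) (multi_indices B)"
    by (rule majorized_expansionE[OF g B])
  have "norm (g v) \<le> N'"
    by (rule norm_infsum_le[OF c(4)[THEN spec, THEN mp, OF v] c(1)])
       (auto simp: abs_mult intro!: mult_left_mono abs_monomial_le B v)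
  with c(3) show ?thesis by simp
qed

definition analytic_at_point :: "'a::euclidean_space set \<Rightarrow> 'a \<Rightarrow> ('a \<Rightarrow> real) \<Rightarrow> bool" where
  "analytic_at_point B a g \<longleftrightarrow> (\<exists>\<delta>>0. \<exists>N. majorized_expansion B a \<delta> N g)"

lemma analytic_at_point_common:
  assumes "finite B" "analytic_at_point B a f" "analytic_at_point B a g"
  obtains \<delta> M N where "\<delta> > 0" "majorized_expansion B a \<delta> M f" "majorized_expansion B a \<delta> N g"
proof -
  obtain \<delta>1 M where f: "\<delta>1 > 0" "majorized_expansion B a \<delta>1 M f"
    using assms unfolding analytic_at_point_def by blast
  obtain \<delta>2 N where g: "\<delta>2 > 0" "majorized_expansion B a \<delta>2 N g"
    using assms unfolding analytic_at_point_def by blast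
  define \<delta> where "\<delta> = min \<delta>1 \<delta>2"
  have "\<delta> > 0" using f g by (simp add: \<delta>_def)
  have "\<exists>M. majorized_expansion B a \<delta> M f"
    using majorized_expansion_shrink[OF assms(1) f, of "\<delta> / \<delta>1"] f \<open>\<delta> > 0\<close>
    by (auto simp: \<delta>_def)
  moreover have "\<exists>N. majorized_expansion B a \<delta> N g"
    using majorized_expansion_shrink[OF assms(1) g, of "\<delta> / \<delta>2"] g \<open>\<delta> > 0\<close>
    by (auto simp: \<delta>_def)
  ultimately show ?thesis using that \<open>\<delta> > 0\<close> by blast
qed

text \<open>
  Expand \<open>h\<close> about \<open>g a\<close>. On a box where \<open>g - g a\<close> has norm at most \<open>\<rho>\<close>, half the radius of a
  disc about \<open>g a\<close> inside \<open>S\<close>, the powers of \<open>g - g a\<close> have norms at most \<open>\<rho> ^ n\<close>, so that the substituted series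
  converges in norm.
\<close>

lemma analytic_at_point_holomorphic:
  assumes B: "finite B" and g: "analytic_at_point B a g"
    and h: "h holomorphic_on S" "open S" "of_real (g a) \<in> S"
  shows "analytic_at_point B a (\<lambda>v. Re (h (of_real (g v))))"
proof -
  obtain R where R: "R > 0" "ball (of_real (g a)) R \<subseteq> S"
    using h(2,3) open_contains_ball by blast
  define w0 :: complex where "w0 = of_real (g a)"
  define \<rho> where "\<rho> = R / 2"
  have "analytic_at_point B a (\<lambda>v. - g a)"
    unfolding analytic_at_point_def using majorized_expansion_const[OF B, of 1 a "- g a"] zero_less_one by blast
  then obtain \<delta> M N where \<delta>: "\<delta> > 0" "majorized_expansion B a \<delta> M g" "majorized_expansion B a \<delta> N (\<lambda>v. - g a)"
    by (rule analytic_at_point_common[OF B g])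
  define K where "K = M + N"
  have u: "majorized_expansion B a \<delta> K (\<lambda>v. g v - g a)"
    using majorized_expansion_add[OF B \<delta>(1) \<delta>(2,3)] by (simp add: K_def)
  have K: "K \<ge> 0" using u \<delta>(1) by (rule majorized_expansion_nonneg)
  \<comment> \<open>Since \<open>g - g a\<close> vanishes at \<open>a\<close>, shrinking by \<open>t\<close> brings its norm \<open>K\<close> below \<open>\<rho>\<close>; the summand \<open>1\<close> covers \<open>K = 0\<close>.\<close>
  define t where "t = min 1 (\<rho> / (K + 1))"
  have t: "0 < t" "t \<le> 1" using K R by (auto simp: t_def \<rho>_def)
  have "t * K \<le> \<rho>"
  proof -
    have "t * K \<le> \<rho> / (K + 1) * K" using K by (intro mult_right_mono) (auto simp: t_def)
    also have "\<dots> \<le> \<rho>" using K R by (simp add: field_simps \<rho>_def)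
    finally show ?thesis .
  qed
  with majorized_expansion_shrink[OF B \<delta>(1) u t]
  have u: "majorized_expansion B a (t * \<delta>) \<rho> (\<lambda>v. g v - g a)"
    by (auto intro: majorized_expansion_mono)
  have t\<delta>: "t * \<delta> > 0" using t \<delta> by simp
  define c where "c n = (deriv ^^ n) h w0 / fact n" for n
  have holo: "h holomorphic_on ball w0 R"
    using h(1) R(2) unfolding w0_def by (rule holomorphic_on_subset)
  have c: "(\<lambda>n. c n * (w - w0) ^ n) sums h w" if "w \<in> ball w0 R" for w
    using holomorphic_power_series[OF holo that] unfolding c_def .
  have summable: "summable (\<lambda>n. norm (c n * of_real \<rho> ^ n))"
  proof (rule powser_insidea)
    \<comment> \<open>The radius \<open>3 / 2 * \<rho>\<close> lies strictly between \<open>\<rho>\<close> and \<open>R = 2 * \<rho>\<close>.\<close>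
    show "summable (\<lambda>n. c n * of_real (3 / 2 * \<rho>) ^ n)"
      using sums_summable[OF c[of "w0 + of_real (3 / 2 * \<rho>)"]] R by (simp add: dist_norm \<rho>_def)
  qed (use R in \<open>simp add: \<rho>_def\<close>)
  have "majorized_expansion B a (t * \<delta>) (\<bar>Re (c n)\<bar> * \<rho> ^ n) (\<lambda>v. Re (c n) * (g v - g a) ^ n)" for n
    by (rule majorized_expansion_mult[OF B t\<delta> majorized_expansion_const[OF B t\<delta>]
         majorized_expansion_power[OF B t\<delta> u]])
  moreover have "summable (\<lambda>n. \<bar>Re (c n)\<bar> * \<rho> ^ n)"
    using R by (intro summable_comparison_test'[OF summable, of 0])
      (auto simp: norm_mult norm_power abs_mult \<rho>_def intro!: mult_right_mono abs_Re_le_cmod)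
  ultimately have "majorized_expansion B a (t * \<delta>) (\<Sum>n. \<bar>Re (c n)\<bar> * \<rho> ^ n) (\<lambda>v. \<Sum>n. Re (c n) * (g v - g a) ^ n)"
    by (rule majorized_expansion_suminf[OF B t\<delta>])
  then have "majorized_expansion B a (t * \<delta>) (\<Sum>n. \<bar>Re (c n)\<bar> * \<rho> ^ n) (\<lambda>v. Re (h (of_real (g v))))"
  proof (rule majorized_expansion_cong)
    fix v assume "\<forall>b\<in>B. \<bar>(v - a) \<bullet> b\<bar> \<le> t * \<delta>"
    with majorized_expansion_bound[OF B t\<delta> u] have "\<bar>g v - g a\<bar> \<le> \<rho>" by blast
    moreover have "dist w0 (of_real (g v)) = \<bar>g v - g a\<bar>"
      by (simp add: dist_norm w0_def abs_minus_commute flip: of_real_diff)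
    ultimately have "of_real (g v) \<in> ball w0 R"
      using R by (simp add: \<rho>_def)
    from sums_Re[OF c[OF this]]
    have "(\<lambda>n. Re (c n) * (g v - g a) ^ n) sums Re (h (of_real (g v)))"
      by (simp add: w0_def flip: of_real_diff of_real_power)
    then show "(\<Sum>n. Re (c n) * (g v - g a) ^ n) = Re (h (of_real (g v)))"
      by (rule sums_unique[symmetric])
  qed
  with t\<delta> show ?thesis unfolding analytic_at_point_def by blast
qed

lemma smooth_functions_analytic:
  assumes B: "finite B"
  shows "smooth_functions (\<lambda>g. \<forall>a\<in>V. analytic_at_point B a g) B V"
proof
  have const: "analytic_at_point B a (\<lambda>v. c)" for a c
    unfolding analytic_at_point_def using majorized_expansion_const[OF B, of 1 a c] zero_less_one by blast
  have add: "analytic_at_point B a (\<lambda>v. f v + g v)" if fg: "analytic_at_point B a f" "analytic_at_point B a g" for a f g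
  proof -
    obtain \<delta> M N where \<delta>: "\<delta> > 0" "majorized_expansion B a \<delta> M f" "majorized_expansion B a \<delta> N g"
      by (rule analytic_at_point_common[OF B fg])
    then show ?thesis
      using majorized_expansion_add[OF B \<delta>] unfolding analytic_at_point_def by blast
  qed
  have mult: "analytic_at_point B a (\<lambda>v. f v * g v)" if fg: "analytic_at_point B a f" "analytic_at_point B a g" for a f g
  proof -
    obtain \<delta> M N where \<delta>: "\<delta> > 0" "majorized_expansion B a \<delta> M f" "majorized_expansion B a \<delta> N g"
      by (rule analytic_at_point_common[OF B fg])
    then show ?thesis
      using majorized_expansion_mult[OF B \<delta>] unfolding analytic_at_point_def by blast
  qed
  show "\<forall>a\<in>V. analytic_at_point B a (\<lambda>v. c)" for c by (simp add: const)
  show "\<forall>a\<in>V. analytic_at_point B a (\<lambda>v. f v + g v)"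
    if "\<forall>a\<in>V. analytic_at_point B a f" "\<forall>a\<in>V. analytic_at_point B a g" for f g
    using that add by blast
  show "\<forall>a\<in>V. analytic_at_point B a (\<lambda>v. f v * g v)"
    if "\<forall>a\<in>V. analytic_at_point B a f" "\<forall>a\<in>V. analytic_at_point B a g" for f g
    using that mult by blast
  show "\<forall>a\<in>V. analytic_at_point B a (\<lambda>v. v \<bullet> b)" if "b \<in> B" for b
  proof
    fix a
    have "analytic_at_point B a (\<lambda>v. (v - a) \<bullet> b)"
      unfolding analytic_at_point_def using majorized_expansion_coord[OF B, of 1 b a] that by (auto intro!: exI[of _ 1])
    from add[OF this const[of a "a \<bullet> b"]] show "analytic_at_point B a (\<lambda>v. v \<bullet> b)"
      by (simp add: inner_diff_left)
  qed
  show "\<forall>a\<in>V. analytic_at_point B a (\<lambda>v. Re (h (of_real (f v))))"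
    if "\<forall>a\<in>V. analytic_at_point B a f" "h holomorphic_on S" "open S" "\<And>v. v \<in> V \<Longrightarrow> of_real (f v) \<in> S" for f h S
    using analytic_at_point_holomorphic[OF B] that by blast
qed

lemma real_analytic_onI:
  assumes B: "finite B" "B \<subseteq> Basis" and "\<And>a. a \<in> V \<Longrightarrow> analytic_at_point B a g"
  shows "real_analytic_on B V g"
  unfolding real_analytic_on_def
proof
  fix a assume "a \<in> V"
  then obtain \<delta> N where \<delta>: "\<delta> > 0" "majorized_expansion B a \<delta> N g"
    using assms(3) unfolding analytic_at_point_def by blast
  obtain c N' where "((\<lambda>\<alpha>. \<bar>c \<alpha>\<bar> * \<delta> ^ sum \<alpha> B) has_sum N') (multi_indices B)" "0 \<le> N'" "N' \<le> N" and c: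
    "\<forall>v. (\<forall>b\<in>B. \<bar>(v - a) \<bullet> b\<bar> \<le> \<delta>) \<longrightarrow>
       ((\<lambda>\<alpha>. c \<alpha> * monomial B \<alpha> (v - a)) has_sum g v) (multi_indices B)"
    by (rule majorized_expansionE[OF \<delta>(2) B(1) \<delta>(1)])
  have "((\<lambda>\<alpha>. c \<alpha> * (\<Prod>b\<in>B. ((v - a) \<bullet> b) ^ \<alpha> b)) has_sum g v) (B \<rightarrow>\<^sub>E UNIV)"
    if "dist v a < \<delta>" for v
    unfolding monomial_def[symmetric] multi_indices_def[symmetric]
  proof (rule c[THEN spec, THEN mp], rule ballI)
    fix b assume "b \<in> B"
    then have "\<bar>(v - a) \<bullet> b\<bar> \<le> norm (v - a)" using B by (intro Basis_le_norm) auto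
    then show "\<bar>(v - a) \<bullet> b\<bar> \<le> \<delta>" using that by (simp add: dist_norm)
  qed
  with \<delta>(1) show "\<exists>c. \<exists>\<delta>>0. \<forall>v\<in>V. dist v a < \<delta> \<longrightarrow>
        ((\<lambda>\<alpha>. c \<alpha> * (\<Prod>b\<in>B. ((v - a) \<bullet> b) ^ \<alpha> b)) has_sum g v) (B \<rightarrow>\<^sub>E UNIV)" by blast
qed

section \<open>Finitely differentiable functions\<close>

lemma C_diff_on_cong:
  assumes "\<And>v. v \<in> V \<Longrightarrow> f v = g v"
  shows "C_diff_on B r V f \<longleftrightarrow> C_diff_on B r V g"
proof (cases r)
  case 0
  then show ?thesis using continuous_on_cong[of V V f g] assms by simp
next
  case (Suc r)
  have "(f has_derivative D) (at v within V) \<longleftrightarrow> (g has_derivative D) (at v within V)" if "v \<in> V" for v D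
    using has_derivative_transform[OF that, of f g D] has_derivative_transform[OF that, of g f D] assms by auto
  then show ?thesis using Suc by simp
qed

lemma C_diff_on_SucI:
  assumes "\<And>v. v \<in> V \<Longrightarrow> (g has_derivative g' v) (at v within V)"
    and "\<And>b. b \<in> B \<Longrightarrow> C_diff_on B r V (\<lambda>v. g' v b)"
  shows "C_diff_on B (Suc r) V g"
  using assms by auto

lemma C_diff_on_Suc_imp: "C_diff_on B (Suc r) V g \<Longrightarrow> C_diff_on B r V g"
proof (induction r arbitrary: g)
  case 0
  then show ?case
    by (auto simp: continuous_on_eq_continuous_within intro: has_derivative_continuous)
next
  case (Suc r)
  from Suc.prems obtain g' where g: "\<forall>v\<in>V. (g has_derivative g' v) (at v within V)"
    "\<forall>b\<in>B. C_diff_on B (Suc r) V (\<lambda>v. g' v b)" by (subst (asm) C_diff_on.simps(2)) blast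
  show ?case by (rule C_diff_on_SucI[OF g(1)[rule_format]]) (use g(2) Suc.IH in blast)+
qed

lemma C_diff_on_const: "C_diff_on B r V (\<lambda>_. c)"
proof (induction r arbitrary: c)
  case (Suc r)
  show ?case by (rule C_diff_on_SucI[where g' = "\<lambda>_ _. 0"]) (auto intro: Suc)
qed auto

lemma C_diff_on_add: "C_diff_on B r V f \<Longrightarrow> C_diff_on B r V g \<Longrightarrow> C_diff_on B r V (\<lambda>v. f v + g v)"
proof (induction r arbitrary: f g)
  case 0
  then show ?case by (auto intro: continuous_on_add)
next
  case (Suc r)
  from Suc.prems(1) obtain f' where f: "\<forall>v\<in>V. (f has_derivative f' v) (at v within V)"
    "\<forall>b\<in>B. C_diff_on B r V (\<lambda>v. f' v b)" by auto
  note f = f[rule_format]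
  from Suc.prems(2) obtain g' where g: "\<forall>v\<in>V. (g has_derivative g' v) (at v within V)"
    "\<forall>b\<in>B. C_diff_on B r V (\<lambda>v. g' v b)" by auto
  note g = g[rule_format]
  show ?case
    by (rule C_diff_on_SucI[OF has_derivative_add[OF f(1) g(1)]]) (auto intro: Suc.IH f g)
qed

lemma C_diff_on_mult: "C_diff_on B r V f \<Longrightarrow> C_diff_on B r V g \<Longrightarrow> C_diff_on B r V (\<lambda>v. f v * g v)"
proof (induction r arbitrary: f g)
  case 0
  then show ?case by (auto intro: continuous_on_mult)
next
  case (Suc r)
  from Suc.prems(1) obtain f' where f: "\<forall>v\<in>V. (f has_derivative f' v) (at v within V)"
    "\<forall>b\<in>B. C_diff_on B r V (\<lambda>v. f' v b)" by auto
  note f = f[rule_format]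
  from Suc.prems(2) obtain g' where g: "\<forall>v\<in>V. (g has_derivative g' v) (at v within V)"
    "\<forall>b\<in>B. C_diff_on B r V (\<lambda>v. g' v b)" by auto
  note g = g[rule_format]
  note lower = Suc.prems[THEN C_diff_on_Suc_imp]
  show ?case
    by (rule C_diff_on_SucI[OF has_derivative_mult[OF f(1) g(1)]])
       (auto intro!: C_diff_on_add Suc.IH f g lower)
qed

lemma C_diff_on_inner: "C_diff_on B r V (\<lambda>v. v \<bullet> b)"
proof (cases r)
  case 0
  then show ?thesis by (auto intro!: continuous_intros)
next
  case (Suc s)
  have "C_diff_on B (Suc s) V (\<lambda>v. v \<bullet> b)"
    by (rule C_diff_on_SucI[where g' = "\<lambda>_ h. h \<bullet> b"]) (auto intro!: derivative_eq_intros C_diff_on_const)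
  with Suc show ?thesis by simp
qed

text \<open>
  The partial derivatives of the composition involve \<open>deriv h\<close>, which is again holomorphic; hence the
  induction over all \<open>h\<close> at once.
\<close>

lemma C_diff_on_holomorphic:
  assumes "C_diff_on B r V g" "h holomorphic_on S" "open S" "\<And>v. v \<in> V \<Longrightarrow> of_real (g v) \<in> S"
  shows "C_diff_on B r V (\<lambda>v. Re (h (of_real (g v))))"
  using assms(1,2)
proof (induction r arbitrary: h)
  case 0
  then have "continuous_on V g" "continuous_on S h" by (auto intro: holomorphic_on_imp_continuous_on)
  then show ?case
    using assms(4) by (auto intro!: continuous_intros intro: continuous_on_compose2[of S h])
next
  case (Suc r)
  from Suc.prems(1) obtain g' where g: "\<forall>v\<in>V. (g has_derivative g' v) (at v within V)"
    "\<forall>b\<in>B. C_diff_on B r V (\<lambda>v. g' v b)" by auto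
  note g = g[rule_format]
  show ?case
  proof (rule C_diff_on_SucI)
    fix v assume v: "v \<in> V"
    have h: "(h has_field_derivative deriv h (of_real (g v))) (at (of_real (g v)))"
      using holomorphic_derivI[OF Suc.prems(2) assms(3) assms(4)[OF v]] .
    have "((\<lambda>v. of_real (g v) :: complex) has_derivative (\<lambda>x. of_real (g' v x))) (at v within V)"
      using g(1)[OF v] by (rule has_derivative_of_real)
    from has_derivative_compose[OF this h[unfolded has_field_derivative_def]]
    have "((\<lambda>v. h (of_real (g v))) has_derivative (\<lambda>x. deriv h (of_real (g v)) * of_real (g' v x))) (at v within V)" .
    from has_derivative_Re[OF this]
    show "((\<lambda>v. Re (h (of_real (g v)))) has_derivative (\<lambda>x. Re (deriv h (of_real (g v))) * g' v x)) (at v within V)"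
      by simp
  next
    fix b assume "b \<in> B"
    show "C_diff_on B r V (\<lambda>v. Re (deriv h (of_real (g v))) * g' v b)"
      by (intro C_diff_on_mult g \<open>b \<in> B\<close> Suc.IH C_diff_on_Suc_imp[OF Suc.prems(1)]
            holomorphic_deriv[OF Suc.prems(2) assms(3)])
  qed
qed

lemma smooth_functions_C_diff: "smooth_functions (C_diff_on B r V) B V"
  by standard (auto intro: C_diff_on_const C_diff_on_inner C_diff_on_add C_diff_on_mult C_diff_on_holomorphic)

section \<open>The profile as a function of the distance to a subspace\<close>

text \<open>
  Polynomials in the coordinates of the unit vector \<open>snd v / norm (snd v)\<close>. They are homogeneous of
  degree \<open>0\<close> and bounded, but in general discontinuous where \<open>snd v = 0\<close>. There division by zero
  sets the coordinates of the unit vector to \<open>0\<close>.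
\<close>

inductive angular_polynomial :: "('a::euclidean_space \<times> 'b::euclidean_space \<Rightarrow> real) \<Rightarrow> bool" where
  const: "angular_polynomial (\<lambda>_. c)"
| coord: "angular_polynomial (\<lambda>v. snd v \<bullet> c / norm (snd v))"
| add: "angular_polynomial p \<Longrightarrow> angular_polynomial q \<Longrightarrow> angular_polynomial (\<lambda>v. p v + q v)"
| mult: "angular_polynomial p \<Longrightarrow> angular_polynomial q \<Longrightarrow> angular_polynomial (\<lambda>v. p v * q v)"

lemma angular_polynomial_bounded:
  "angular_polynomial p \<Longrightarrow> \<exists>C. \<forall>v. \<bar>p v\<bar> \<le> C"
proof (induction rule: angular_polynomial.induct)
  case (const c)
  then show ?case by blast
next
  case (coord c)
  have "\<bar>snd v \<bullet> c / norm (snd v)\<bar> \<le> norm c" for v :: "'a \<times> 'b"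
    using Cauchy_Schwarz_ineq2[of "snd v" c] by (cases "snd v = 0") (auto simp: field_simps)
  then show ?case by blast
next
  case (add p q)
  then obtain C D where "\<forall>v. \<bar>p v\<bar> \<le> C" "\<forall>v. \<bar>q v\<bar> \<le> D" by blast
  then have "\<forall>v. \<bar>p v + q v\<bar> \<le> C + D" by (meson abs_triangle_ineq add_mono order_trans)
  then show ?case by blast
next
  case (mult p q)
  then obtain C D where C: "\<forall>v. \<bar>p v\<bar> \<le> C" and D: "\<forall>v. \<bar>q v\<bar> \<le> D" by blast
  have "\<bar>p v * q v\<bar> \<le> C * D" for v
    unfolding abs_mult using C[rule_format, of v] D[rule_format, of v] by (intro mult_mono) auto
  then show ?case by blast
qed

lemma has_derivative_norm_snd:
  fixes v :: "'a::euclidean_space \<times> 'b::euclidean_space"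
  assumes "snd v \<noteq> 0"
  shows "((\<lambda>v. norm (snd v)) has_derivative (\<lambda>h. snd v \<bullet> snd h / norm (snd v))) (at v)"
proof -
  have "(norm has_derivative (\<lambda>h. h \<bullet> sgn (snd v))) (at (snd v))"
    using GDERIV_norm[OF assms] by (simp add: gderiv_def)
  from has_derivative_compose[OF has_derivative_snd[OF has_derivative_ident] this]
  show ?thesis by (simp add: sgn_div_norm inner_commute divide_inverse mult.commute)
qed

text \<open>
  For \<open>u = x / norm x\<close> the derivative of \<open>u \<bullet> c\<close> in direction \<open>h\<close> is
  \<open>(h \<bullet> c - (u \<bullet> c) * (u \<bullet> h)) / norm x\<close>: again an angular polynomial, apart from the factor
  \<open>1 / norm x\<close>. The product rule does the rest.
\<close>

lemma angular_polynomial_derivative: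
  "angular_polynomial p \<Longrightarrow> \<exists>D. (\<forall>h. angular_polynomial (\<lambda>v. D v h)) \<and>
     (\<forall>v. snd v \<noteq> 0 \<longrightarrow> (p has_derivative (\<lambda>h. D v h / norm (snd v))) (at v))"
proof (induction rule: angular_polynomial.induct)
  case (const c)
  then show ?case
    by (intro exI[of _ "\<lambda>_ _. 0"]) (auto intro: angular_polynomial.const)
next
  case (coord c)
  let ?D = "\<lambda>(v :: 'a \<times> 'b) (h :: 'a \<times> 'b). snd h \<bullet> c +
    (- 1) * ((snd v \<bullet> c / norm (snd v)) * (snd v \<bullet> snd h / norm (snd v)))"
  have "((\<lambda>v. snd v \<bullet> c / norm (snd v)) has_derivative (\<lambda>h. ?D v h / norm (snd v))) (at v)"
    if v: "snd v \<noteq> 0" for v :: "'a \<times> 'b"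
  proof -
    have "((\<lambda>v. snd v \<bullet> c) has_derivative (\<lambda>h. snd h \<bullet> c)) (at v)"
      by (auto intro!: derivative_eq_intros)
    from has_derivative_divide'[OF this has_derivative_norm_snd[OF v]] v
    show ?thesis by (simp add: field_simps power2_eq_square)
  qed
  then show ?case
    by (intro exI[of _ ?D]) (intro conjI allI impI angular_polynomial.intros; blast)
next
  case (add p q)
  then obtain D E where D: "\<forall>h. angular_polynomial (\<lambda>v. D v h)"
      "\<forall>v. snd v \<noteq> 0 \<longrightarrow> (p has_derivative (\<lambda>h. D v h / norm (snd v))) (at v)"
    and E: "\<forall>h. angular_polynomial (\<lambda>v. E v h)"
      "\<forall>v. snd v \<noteq> 0 \<longrightarrow> (q has_derivative (\<lambda>h. E v h / norm (snd v))) (at v)" by blast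
  show ?case
  proof (intro exI[of _ "\<lambda>v h. D v h + E v h"] conjI allI impI)
    fix v :: "'a \<times> 'b" assume "snd v \<noteq> 0"
    with D(2) E(2) have "((\<lambda>v. p v + q v) has_derivative (\<lambda>h. D v h / norm (snd v) + E v h / norm (snd v))) (at v)"
      by (intro has_derivative_add) blast+
    then show "((\<lambda>v. p v + q v) has_derivative (\<lambda>h. (D v h + E v h) / norm (snd v))) (at v)"
      by (simp add: add_divide_distrib)
  qed (use D E in \<open>auto intro: angular_polynomial.add\<close>)
next
  case (mult p q)
  then obtain D E where D: "\<forall>h. angular_polynomial (\<lambda>v. D v h)"
      "\<forall>v. snd v \<noteq> 0 \<longrightarrow> (p has_derivative (\<lambda>h. D v h / norm (snd v))) (at v)"
    and E: "\<forall>h. angular_polynomial (\<lambda>v. E v h)"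
      "\<forall>v. snd v \<noteq> 0 \<longrightarrow> (q has_derivative (\<lambda>h. E v h / norm (snd v))) (at v)" by blast
  show ?case
  proof (intro exI[of _ "\<lambda>v h. p v * E v h + D v h * q v"] conjI allI impI)
    fix v :: "'a \<times> 'b" assume "snd v \<noteq> 0"
    with D(2) E(2) have "((\<lambda>v. p v * q v) has_derivative
        (\<lambda>h. p v * (E v h / norm (snd v)) + D v h / norm (snd v) * q v)) (at v)"
      by (intro has_derivative_mult) blast+
    then show "((\<lambda>v. p v * q v) has_derivative (\<lambda>h. (p v * E v h + D v h * q v) / norm (snd v))) (at v)"
      by (simp add: add_divide_distrib)
  qed (use D E mult.hyps in \<open>auto intro!: angular_polynomial.add angular_polynomial.mult\<close>)
qed

lemma has_derivative_zero_if_quadratic: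
  fixes f :: "'a::euclidean_space \<times> 'b::euclidean_space \<Rightarrow> real"
  assumes v: "snd v = 0" and "d > 0"
    and f: "\<And>w. norm (snd w) < d \<Longrightarrow> \<bar>f w\<bar> \<le> C * (norm (snd w))\<^sup>2"
  shows "(f has_derivative (\<lambda>_. 0)) (at v)"
  unfolding has_derivative_at
proof
  have fv: "f v = 0" using f[of v] v \<open>d > 0\<close> by simp
  show "(\<lambda>h. norm (f (v + h) - f v - 0) / norm h) \<midarrow>0\<rightarrow> 0"
  proof (rule Lim_null_comparison)
    have "\<forall>\<^sub>F h in at 0. norm (h :: 'a \<times> 'b) < d"
      using \<open>d > 0\<close> by (auto simp: eventually_at dist_norm)
    then show "\<forall>\<^sub>F h in at 0. norm (norm (f (v + h) - f v - 0) / norm h) \<le> \<bar>C\<bar> * norm h"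
    proof eventually_elim
      case (elim h)
      have snd: "norm (snd h) \<le> norm h" using norm_snd_le[of "snd h" "fst h"] by simp
      have "\<bar>f (v + h)\<bar> \<le> C * (norm (snd h))\<^sup>2" using f[of "v + h"] elim snd v by simp
      also have "\<dots> \<le> \<bar>C\<bar> * (norm h)\<^sup>2" using snd by (intro mult_mono power_mono) auto
      finally have "\<bar>f (v + h)\<bar> / norm h \<le> \<bar>C\<bar> * norm h"
        by (cases "h = 0") (auto simp: field_simps power2_eq_square)
      then show ?case using fv by simp
    qed
    show "(\<lambda>h. \<bar>C\<bar> * norm h) \<midarrow>0\<rightarrow> 0" by (auto intro!: tendsto_eq_intros)
  qed
qed simp

text \<open>
  A derivative of \<open>norm x ^ (r + 2) * p\<close> has the form \<open>norm x ^ (r + 1) * q\<close> with \<open>q\<close> again an angular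
  polynomial. At \<open>x = 0\<close> this form gives the correct value \<open>0\<close> because the function vanishes to second
  order. After \<open>r\<close> derivatives one factor \<open>norm x\<close> is left,
  which secures continuity.
\<close>

lemma C_diff_on_norm_power_angular:
  fixes p :: "'a::euclidean_space \<times> 'b::euclidean_space \<Rightarrow> real"
  assumes "angular_polynomial p"
  shows "C_diff_on B r V (\<lambda>v. norm (snd v) ^ (r + 1) * p v)"
  using assms
proof (induction r arbitrary: p)
  case (0 p)
  obtain C where C: "\<forall>v. \<bar>p v\<bar> \<le> C" using angular_polynomial_bounded[OF 0] by blast
  have "isCont (\<lambda>v. norm (snd v) * p v) v" for v
  proof (cases "snd v = 0")
    case True
    have "((\<lambda>w. norm (snd w) * p w) \<longlongrightarrow> 0) (at v)"
    proof (rule Lim_null_comparison)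
      show "\<forall>\<^sub>F w in at v. norm (norm (snd w) * p w) \<le> norm (snd w) * C"
        by (intro always_eventually allI) (auto simp: abs_mult C intro!: mult_left_mono)
      show "((\<lambda>w. norm (snd w) * C) \<longlongrightarrow> 0) (at v)"
        using True by (auto intro!: tendsto_eq_intros)
    qed
    then show ?thesis using True by (simp add: isCont_def)
  next
    case False
    obtain D where "(p has_derivative D) (at v)"
      using angular_polynomial_derivative[OF 0] False by blast
    then show ?thesis by (intro continuous_intros has_derivative_continuous)
  qed
  then show ?case by (simp add: continuous_at_imp_continuous_on)
next
  case (Suc r p)
  obtain C where C: "\<forall>v. \<bar>p v\<bar> \<le> C" using angular_polynomial_bounded[OF Suc.prems] by blast
  obtain D where D: "\<forall>h. angular_polynomial (\<lambda>v. D v h)"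
      "\<forall>v. snd v \<noteq> 0 \<longrightarrow> (p has_derivative (\<lambda>h. D v h / norm (snd v))) (at v)"
    using angular_polynomial_derivative[OF Suc.prems] by blast
  let ?q = "\<lambda>h v. real (r + 2) * ((snd v \<bullet> snd h / norm (snd v)) * p v) + D v h"
  show ?case
  proof (rule C_diff_on_SucI[where g' = "\<lambda>v h. norm (snd v) ^ (r + 1) * ?q h v"])
    fix b :: "'a \<times> 'b"
    show "C_diff_on B r V (\<lambda>v. norm (snd v) ^ (r + 1) * ?q b v)"
      by (rule Suc.IH) (intro angular_polynomial.intros Suc.prems D(1)[rule_format])
  next
    fix v
    show "((\<lambda>v. norm (snd v) ^ (Suc r + 1) * p v) has_derivative
      (\<lambda>h. norm (snd v) ^ (r + 1) * ?q h v)) (at v within V)"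
    proof (cases "snd v = 0")
      case True
      have "((\<lambda>v. norm (snd v) ^ (Suc r + 1) * p v) has_derivative (\<lambda>_. 0)) (at v)"
      proof (rule has_derivative_zero_if_quadratic[OF True zero_less_one])
        fix w :: "'a \<times> 'b" assume "norm (snd w) < 1"
        then have "norm (snd w) ^ (Suc r + 1) \<le> (norm (snd w))\<^sup>2"
          by (intro power_decreasing) auto
        then have "norm (snd w) ^ (Suc r + 1) * \<bar>p w\<bar> \<le> (norm (snd w))\<^sup>2 * C"
          using C[rule_format, of w] by (intro mult_mono) auto
        then show "\<bar>norm (snd w) ^ (Suc r + 1) * p w\<bar> \<le> C * (norm (snd w))\<^sup>2"
          by (simp add: abs_mult mult.commute)
      qed
      then show ?thesis using True by (auto intro: has_derivative_at_withinI)
    next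
      case False
      have "((\<lambda>v. norm (snd v) ^ (r + 2)) has_derivative
          (\<lambda>h. real (r + 2) * (snd v \<bullet> snd h / norm (snd v)) * norm (snd v) ^ (r + 1))) (at v)"
        using has_derivative_power[OF has_derivative_norm_snd[OF False], of "r + 2"] by simp
      from has_derivative_mult[OF this D(2)[rule_format, OF False]]
      have "((\<lambda>v. norm (snd v) ^ (Suc r + 1) * p v) has_derivative
        (\<lambda>h. norm (snd v) ^ (r + 1) * ?q h v)) (at v)"
        using False by (simp add: algebra_simps)
      then show ?thesis by (rule has_derivative_at_withinI)
    qed
  qed
qed

lemma norm_sq_eq_sum_inner:
  fixes x :: "'a::euclidean_space"
  shows "(norm x)\<^sup>2 = (\<Sum>b\<in>Basis. (x \<bullet> b)\<^sup>2)"
  unfolding power2_norm_eq_inner euclidean_inner[of x x] by (simp add: power2_eq_square)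

lemma sum_sq_inner_Pair:
  fixes v :: "'a::euclidean_space \<times> 'b::euclidean_space"
  shows "(\<Sum>c\<in>(\<lambda>b. (b, 0)) ` A. (v \<bullet> c)\<^sup>2) = (\<Sum>b\<in>A. (fst v \<bullet> b)\<^sup>2)"
    and "(\<Sum>c\<in>Pair 0 ` C. (v \<bullet> c)\<^sup>2) = (\<Sum>b\<in>C. (snd v \<bullet> b)\<^sup>2)"
  by (subst sum.reindex; auto simp: inj_on_def inner_prod_def)+

text \<open>
  The derivative of \<open>F (norm x)\<close> is \<open>norm x ^ (k - 1)\<close> times an angular polynomial times
  \<open>1 / sqrt (1 - norm x ^ (2 * k - 2))\<close>. The first two factors give a function with \<open>k - 2\<close> continuous
  derivatives, and the third is an analytic function of the polynomial \<open>(norm x)\<^sup>2\<close>.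
\<close>

lemma C_diff_on_arch_integral_norm:
  fixes B V :: "('a::euclidean_space \<times> 'b::euclidean_space) set"
  assumes k: "k \<ge> 2" and B: "Pair 0 ` Basis \<subseteq> B" and V: "V \<subseteq> {v. norm (snd v) < 1}"
  shows "C_diff_on B (k - 1) V (\<lambda>v. arch_integral k (norm (snd v)))"
proof -
  define r where "r = k - 2"
  have r: "k - 1 = Suc r" "2 * k - 2 = 2 * Suc r" using k by (auto simp: r_def)
  define F' where "F' y = y ^ (k - 1) / sqrt (1 - y ^ (2 * k - 2))" for y :: real
  let ?u = "\<lambda>v h :: 'a \<times> 'b. snd v \<bullet> snd h / norm (snd v)"
  have "C_diff_on B (Suc r) V (\<lambda>v. arch_integral k (norm (snd v)))"
  proof (rule C_diff_on_SucI[where g' = "\<lambda>v h. F' (norm (snd v)) * ?u v h"])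
    fix v assume "v \<in> V"
    then have v: "norm (snd v) < 1" using V by auto
    show "((\<lambda>v. arch_integral k (norm (snd v))) has_derivative (\<lambda>h. F' (norm (snd v)) * ?u v h)) (at v within V)"
    proof (cases "snd v = 0")
      case True
      have "((\<lambda>v. arch_integral k (norm (snd v))) has_derivative (\<lambda>_. 0)) (at v)"
        by (rule has_derivative_zero_if_quadratic[OF True, of "1 / 2" _ 2])
           (use arch_integral_bounds[OF k] arch_integral_le_square[OF k] in auto)
      then show ?thesis using True by (auto intro: has_derivative_at_withinI)
    next
      case False
      have "(arch_integral k has_derivative (*) (F' (norm (snd v)))) (at (norm (snd v)))"
        using arch_integral_has_derivative[OF k, of "norm (snd v)"] False v
        unfolding F'_def has_field_derivative_def by simp
      from has_derivative_compose[OF has_derivative_norm_snd[OF False] this]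
      show ?thesis by (rule has_derivative_at_withinI)
    qed
  next
    fix b
    interpret smooth_functions "C_diff_on B r V" B V by (rule smooth_functions_C_diff)
    define H :: "complex \<Rightarrow> complex" where "H z = inverse (csqrt (1 - z ^ (k - 1)))" for z
    have "1 - z ^ (k - 1) \<notin> \<real>\<^sub>\<le>\<^sub>0" if "z \<in> ball 0 1" for z :: complex
      using that k by (intro one_minus_notin_nonpos_Reals) (simp add: norm_power power_less_one_iff)
    then have H: "H holomorphic_on ball 0 1"
      unfolding H_def by (intro holomorphic_intros) fastforce+
    have sq: "C_diff_on B r V (\<lambda>v. \<Sum>c\<in>Pair 0 ` Basis. (v \<bullet> c)\<^sup>2)"
      using B by (intro sum_squares) auto
    have sq_eq: "(\<Sum>c\<in>Pair 0 ` Basis. (v \<bullet> c)\<^sup>2) = (norm (snd v))\<^sup>2" for v :: "'a \<times> 'b"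
      by (simp add: sum_sq_inner_Pair norm_sq_eq_sum_inner)
    have "C_diff_on B r V (\<lambda>v. Re (H (of_real ((norm (snd v))\<^sup>2))))"
      by (rule holomorphic[OF sq[unfolded sq_eq] H open_ball])
         (use V in \<open>auto simp: norm_power power_less_one_iff\<close>)
    from mult[OF C_diff_on_norm_power_angular[OF angular_polynomial.coord[of "snd b"]] this]
    show "C_diff_on B r V (\<lambda>v. F' (norm (snd v)) * ?u v b)"
    proof (rule C_diff_on_cong[THEN iffD1, rotated])
      fix v assume "v \<in> V"
      then have v: "norm (snd v) < 1" using V by auto
      let ?y = "norm (snd v)"
      have e: "(?y\<^sup>2) ^ (k - 1) = ?y ^ (2 * k - 2)"
        by (simp add: right_diff_distrib' flip: power_mult)
      have "?y ^ (2 * k - 2) < 1" using v k by (simp add: power_less_one_iff)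
      then have "csqrt (1 - of_real (?y\<^sup>2) ^ (k - 1)) = of_real (sqrt (1 - ?y ^ (2 * k - 2)))"
        using of_real_sqrt[of "1 - (?y\<^sup>2) ^ (k - 1)"] e by simp
      then have "Re (H (of_real (?y\<^sup>2))) = inverse (sqrt (1 - ?y ^ (2 * k - 2)))"
        unfolding H_def by (simp flip: of_real_inverse)
      then show "?y ^ (r + 1) * ?u v b * Re (H (of_real (?y\<^sup>2))) = F' ?y * ?u v b"
        unfolding F'_def r by (simp add: divide_inverse mult_ac)
    qed
  qed
  then show ?thesis unfolding r .
qed

section \<open>Local graphs\<close>

text \<open>
  On the side of the hyperplane orthogonal to \<open>e\<close> on which \<open>p\<close> lies, the equation
  \<open>(z \<bullet> e)\<^sup>2 = Q z\<close> is solved by a square root with the sign of \<open>p \<bullet> e\<close>.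
\<close>

lemma locally_graph_signed_sqrt:
  fixes S :: "'a::euclidean_space set"
  assumes e: "e \<in> Basis" and p: "p \<in> S" "p \<in> W" "p \<bullet> e \<noteq> 0" and W: "open W"
    and S: "\<And>z. z \<in> W \<Longrightarrow> z \<in> S \<longleftrightarrow> (z \<bullet> e)\<^sup>2 = Q z"
    and W_invariant: "\<And>z t. z \<in> W \<Longrightarrow> z + t *\<^sub>R e \<in> W"
    and Q_invariant: "\<And>z t. Q (z + t *\<^sub>R e) = Q z"
    and Q: "continuous_on W Q"
    and P: "\<And>V. V \<subseteq> W \<Longrightarrow> (\<And>v. v \<in> V \<Longrightarrow> Q v > 0) \<Longrightarrow> P (Basis - {e}) V (\<lambda>v. sgn (p \<bullet> e) * sqrt (Q v))"
  shows "\<exists>e\<in>Basis. \<exists>U V g. open U \<and> p \<in> U \<and> openin (top_of_set (coord_hyperplane e)) V \<and>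
        P (Basis - {e}) V g \<and> S \<inter> U = (\<lambda>v. v + g v *\<^sub>R e) ` V"
proof -
  define \<sigma> where "\<sigma> = sgn (p \<bullet> e)"
  have \<sigma>: "\<sigma> = 1 \<or> \<sigma> = - 1" using p(3) by (simp add: \<sigma>_def sgn_if)
  define g where "g v = \<sigma> * sqrt (Q v)" for v
  define U where "U = W \<inter> {z. \<sigma> * (z \<bullet> e) > 0}"
  define V where "V = coord_hyperplane e \<inter> (W \<inter> Q -` {0<..})"
  have ee: "e \<bullet> e = 1" using e by simp
  have "open U"
    unfolding U_def by (intro open_Int W open_Collect_less continuous_intros)
  moreover have "p \<in> U" using p by (auto simp: U_def \<sigma>_def sgn_if)
  moreover have "openin (top_of_set (coord_hyperplane e)) V"
    unfolding V_def by (intro openin_open_Int continuous_open_preimage[OF Q W] open_greaterThan)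
  moreover have "P (Basis - {e}) V g"
    unfolding g_def \<sigma>_def by (rule P) (auto simp: V_def)
  moreover have "S \<inter> U = (\<lambda>v. v + g v *\<^sub>R e) ` V"
  proof (intro equalityI subsetI)
    fix z assume z: "z \<in> S \<inter> U"
    define v where "v = z + (- (z \<bullet> e)) *\<^sub>R e"
    have zW: "z \<in> W" and pos: "\<sigma> * (z \<bullet> e) > 0" using z by (auto simp: U_def)
    have Qv: "Q v = (z \<bullet> e)\<^sup>2" using S[OF zW] z unfolding v_def Q_invariant by simp
    have "g v = z \<bullet> e" unfolding g_def Qv using pos \<sigma> by auto
    then have "z = v + g v *\<^sub>R e" by (simp add: v_def)
    moreover have "v \<in> V"
      using Qv pos W_invariant[OF zW, of "- (z \<bullet> e)"] ee
      by (auto simp: V_def coord_hyperplane_def v_def inner_diff_left)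
    ultimately show "z \<in> (\<lambda>v. v + g v *\<^sub>R e) ` V" by blast
  next
    fix z assume "z \<in> (\<lambda>v. v + g v *\<^sub>R e) ` V"
    then obtain v where v: "v \<in> W" "v \<bullet> e = 0" "Q v > 0" and z: "z = v + g v *\<^sub>R e"
      by (auto simp: V_def coord_hyperplane_def)
    have zW: "z \<in> W" unfolding z using v(1) by (rule W_invariant)
    have ze: "z \<bullet> e = g v" by (simp add: z inner_add_left v(2) ee)
    have "(g v)\<^sup>2 = Q v" using v(3) \<sigma> by (auto simp: g_def power_mult_distrib)
    moreover have "Q z = Q v" unfolding z by (rule Q_invariant)
    ultimately have "z \<in> S" using S[OF zW] ze by simp
    moreover have "\<sigma> * g v > 0" using v(3) \<sigma> by (auto simp: g_def)
    ultimately show "z \<in> S \<inter> U" using zW by (simp add: U_def ze)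
  qed
  ultimately show ?thesis using e by blast
qed

lemma sum_Basis_remove:
  fixes x :: "'a::euclidean_space"
  assumes "b \<in> Basis"
  shows "(norm x)\<^sup>2 = (x \<bullet> b)\<^sup>2 + (\<Sum>c\<in>Basis - {b}. (x \<bullet> c)\<^sup>2)"
  unfolding norm_sq_eq_sum_inner using assms by (simp add: sum.remove)

lemma sum_inner_remove_invariant:
  fixes x :: "'a::euclidean_space"
  assumes "b \<in> Basis"
  shows "(\<Sum>c\<in>Basis - {b}. ((x + t *\<^sub>R b) \<bullet> c)\<^sup>2) = (\<Sum>c\<in>Basis - {b}. (x \<bullet> c)\<^sup>2)"
  by (rule sum.cong) (use assms in \<open>auto simp: inner_add_left inner_not_same_Basis\<close>)

lemma exists_Basis_inner_nonzero:
  fixes x :: "'a::euclidean_space"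
  assumes "x \<noteq> 0"
  obtains b where "b \<in> Basis" "x \<bullet> b \<noteq> 0"
  using assms euclidean_all_zero_iff[of x] by blast

text \<open>
  The class \<open>P0\<close> carries the closure properties; \<open>transfer\<close> passes to the given notion \<open>P\<close>, which
  depends only on values on \<open>V\<close>. The premise \<open>profile\<close> is needed near points with \<open>x'' \<noteq> 0\<close>, where
  \<open>Q\<close> is built from \<open>F (norm x')\<close>. Near the points with \<open>x'' = 0\<close> the function of \<open>arch_profile_near_1\<close>
  takes its place.
\<close>

lemma locally_graph_arch_spherical_array:
  fixes P P0 :: "((real ^ 'm) \<times> (real ^ 'k)) set \<Rightarrow> _ set \<Rightarrow> (_ \<Rightarrow> real) \<Rightarrow> bool"
  assumes k: "CARD('k) \<ge> 2"
    and smooth: "\<And>B V. B \<subseteq> Basis \<Longrightarrow> smooth_functions (P0 B V) B V"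
    and transfer: "\<And>B V f g. B \<subseteq> Basis \<Longrightarrow> P0 B V f \<Longrightarrow> (\<And>v. v \<in> V \<Longrightarrow> f v = g v) \<Longrightarrow> P B V g"
    and profile: "\<And>B V. B \<subseteq> Basis \<Longrightarrow> Pair 0 ` Basis \<subseteq> B \<Longrightarrow> V \<subseteq> {v. norm (snd v) < 1} \<Longrightarrow>
      \<exists>\<Phi>. P0 B V \<Phi> \<and> (\<forall>v\<in>V. \<Phi> v = arch_integral CARD('k) (norm (snd v)))"
  shows "locally_graph P (arch_spherical_array :: ((real ^ 'm) \<times> (real ^ 'k)) set)"
  unfolding locally_graph_def
proof
  let ?S = "arch_spherical_array :: ((real ^ 'm) \<times> (real ^ 'k)) set"
  define F where "F = arch_integral CARD('k)"
  define M where "M = arch_M CARD('k)"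
  have S: "z \<in> ?S \<longleftrightarrow> norm (snd z) \<le> 1 \<and> norm (fst z) = M - F (norm (snd z))" for z
    using mem_arch_spherical_array[OF k, of "fst z" "snd z"] by (simp add: F_def M_def)
  note F_bounds = arch_integral_bounds[OF k, folded F_def M_def]
  have fst_sq: "(\<Sum>c\<in>(\<lambda>b. (b, 0)) ` Basis. (v \<bullet> c)\<^sup>2) = (norm (fst v))\<^sup>2" for v :: "(real ^ 'm) \<times> (real ^ 'k)"
    by (simp add: sum_sq_inner_Pair norm_sq_eq_sum_inner)
  fix p assume p: "p \<in> ?S"
  show "\<exists>e\<in>Basis. \<exists>U V g. open U \<and> p \<in> U \<and> openin (top_of_set (coord_hyperplane e)) V \<and>
        P (Basis - {e}) V g \<and> ?S \<inter> U = (\<lambda>v. v + g v *\<^sub>R e) ` V"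
  proof (cases "fst p = 0")
    case False
    then obtain b where b: "b \<in> Basis" "fst p \<bullet> b \<noteq> 0" by (rule exists_Basis_inner_nonzero)
    define e :: "(real ^ 'm) \<times> (real ^ 'k)" where "e = (b, 0)"
    define W :: "((real ^ 'm) \<times> (real ^ 'k)) set" where "W = {z. norm (snd z) < 1}"
    define Q where "Q z = (M - F (norm (snd z)))\<^sup>2 - (\<Sum>c\<in>Basis - {b}. (fst z \<bullet> c)\<^sup>2)"
      for z :: "(real ^ 'm) \<times> (real ^ 'k)"
    have e: "e \<in> Basis" using b by (simp add: e_def Basis_prod_def)
    have inner_e: "z \<bullet> e = fst z \<bullet> b" for z by (simp add: e_def inner_prod_def)
    show ?thesis
    proof (rule locally_graph_signed_sqrt[OF e p, where W = W and Q = Q])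
      have "norm (snd p) \<le> 1" "norm (fst p) = M - F (norm (snd p))"
        using p S[of p] by auto
      moreover have "F 1 = M" by (simp add: F_def M_def arch_integral_1)
      ultimately show "p \<in> W" using False by (cases "norm (snd p) = 1") (auto simp: W_def)
      show "p \<bullet> e \<noteq> 0" using b inner_e by simp
      show "open W" unfolding W_def by (intro open_Collect_less continuous_intros)
      show "z \<in> ?S \<longleftrightarrow> (z \<bullet> e)\<^sup>2 = Q z" if "z \<in> W" for z
      proof -
        have z: "norm (snd z) < 1" using that by (simp add: W_def)
        then have "z \<in> ?S \<longleftrightarrow> norm (fst z) = M - F (norm (snd z))"
          using S[of z] by auto
        also have "\<dots> \<longleftrightarrow> (norm (fst z))\<^sup>2 = (M - F (norm (snd z)))\<^sup>2"
          using F_bounds[of "norm (snd z)"] z by (intro power2_eq_iff_nonneg[symmetric]) auto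
        finally show ?thesis
          unfolding sum_Basis_remove[OF b(1)] inner_e Q_def by auto
      qed
      show "z + t *\<^sub>R e \<in> W" if "z \<in> W" for z t using that by (simp add: W_def e_def)
      show "Q (z + t *\<^sub>R e) = Q z" for z t
        by (simp add: Q_def e_def sum_inner_remove_invariant[OF b(1)])
      have "continuous_on W (\<lambda>z. F (norm (snd z)))"
        by (rule continuous_on_compose2[OF continuous_on_arch_integral[OF k, folded F_def]])
           (auto intro!: continuous_intros simp: W_def)
      then show "continuous_on W Q" unfolding Q_def by (intro continuous_intros)
      fix V assume V: "V \<subseteq> W" and pos: "\<And>v. v \<in> V \<Longrightarrow> Q v > 0"
      let ?B = "Basis - {e}"
      let ?C = "(\<lambda>b. (b, 0)) ` (Basis - {b}) :: ((real ^ 'm) \<times> (real ^ 'k)) set"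
      interpret smooth_functions "P0 ?B V" ?B V by (rule smooth) auto
      have "Pair 0 ` Basis \<subseteq> ?B" using b by (auto simp: Basis_prod_def e_def)
      then obtain \<Phi> where \<Phi>: "P0 ?B V \<Phi>" "\<forall>v\<in>V. \<Phi> v = F (norm (snd v))"
        using profile[of ?B V] V unfolding W_def F_def by blast
      have "?C \<subseteq> ?B" by (auto simp: Basis_prod_def e_def)
      then have C: "P0 ?B V (\<lambda>v. \<Sum>c\<in>?C. (v \<bullet> c)\<^sup>2)" by (intro sum_squares) auto
      define f where "f v = (M - \<Phi> v) * (M - \<Phi> v) - (\<Sum>c\<in>?C. (v \<bullet> c)\<^sup>2)" for v
      have "P0 ?B V f" unfolding f_def by (intro minus mult const \<Phi>(1) C)
      moreover have f: "f v = Q v" if "v \<in> V" for v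
        unfolding f_def Q_def sum_sq_inner_Pair using \<Phi>(2) that by (simp add: power2_eq_square)
      ultimately have "P0 ?B V (\<lambda>v. sgn (p \<bullet> e) * Re (csqrt (of_real (f v))))"
        using pos by (intro signed_sqrt) auto
      then show "P ?B V (\<lambda>v. sgn (p \<bullet> e) * sqrt (Q v))"
        by (rule transfer[rotated]) (use f pos in \<open>auto simp flip: of_real_sqrt simp: less_imp_le\<close>)
    qed
  next
    case True
    have M: "M > 0" using arch_M_pos[OF k] by (simp add: M_def)
    obtain g \<epsilon>0 where \<epsilon>0: "\<epsilon>0 > 0" and g: "g holomorphic_on ball 0 (\<epsilon>0\<^sup>2)"
      and g_eq: "\<And>y. 0 \<le> y \<Longrightarrow> y \<le> 1 \<Longrightarrow> M - F y < \<epsilon>0 \<Longrightarrow> y\<^sup>2 = Re (g (of_real ((M - F y)\<^sup>2)))"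
      by (rule arch_profile_near_1[OF k, folded F_def M_def]) (rule that)
    define \<epsilon> where "\<epsilon> = min \<epsilon>0 M"
    have \<epsilon>: "0 < \<epsilon>" "\<epsilon> \<le> \<epsilon>0" "\<epsilon> \<le> M" using \<epsilon>0 M by (auto simp: \<epsilon>_def)
    have p1: "norm (snd p) \<le> 1" "F (norm (snd p)) = M"
      using p S[of p] True by auto
    then have "norm (snd p) = 1"
      using arch_integral_strict_mono[OF k, of "norm (snd p)" 1] arch_integral_1[of "CARD('k)"]
      by (cases "norm (snd p) = 1") (auto simp: F_def M_def)
    then have "snd p \<noteq> 0" by auto
    then obtain b where b: "b \<in> Basis" "snd p \<bullet> b \<noteq> 0" by (rule exists_Basis_inner_nonzero)
    define e :: "(real ^ 'm) \<times> (real ^ 'k)" where "e = (0, b)"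
    define W :: "((real ^ 'm) \<times> (real ^ 'k)) set" where "W = {z. norm (fst z) < \<epsilon>}"
    define Q where "Q z = Re (g (of_real ((norm (fst z))\<^sup>2))) - (\<Sum>c\<in>Basis - {b}. (snd z \<bullet> c)\<^sup>2)"
      for z :: "(real ^ 'm) \<times> (real ^ 'k)"
    have e: "e \<in> Basis" using b by (simp add: e_def Basis_prod_def)
    have inner_e: "z \<bullet> e = snd z \<bullet> b" for z by (simp add: e_def inner_prod_def)
    have in_ball: "of_real ((norm (fst z))\<^sup>2) \<in> ball (0::complex) (\<epsilon>0\<^sup>2)" if "z \<in> W" for z
      using that \<epsilon> by (auto simp: W_def norm_power intro!: power_strict_mono)
    show ?thesis
    proof (rule locally_graph_signed_sqrt[OF e p, where W = W and Q = Q])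
      show "p \<in> W" using True \<epsilon> by (simp add: W_def)
      show "p \<bullet> e \<noteq> 0" using b inner_e by simp
      show "open W" unfolding W_def by (intro open_Collect_less continuous_intros)
      show "z \<in> ?S \<longleftrightarrow> (z \<bullet> e)\<^sup>2 = Q z" if "z \<in> W" for z
      proof -
        have z: "norm (fst z) < \<epsilon>" using that by (simp add: W_def)
        have "z \<in> ?S \<longleftrightarrow> (norm (snd z))\<^sup>2 = Re (g (of_real ((norm (fst z))\<^sup>2)))"
        proof
          assume "z \<in> ?S"
          then show "(norm (snd z))\<^sup>2 = Re (g (of_real ((norm (fst z))\<^sup>2)))"
            using S[of z] g_eq[of "norm (snd z)"] z \<epsilon> by auto
        next
          assume eq: "(norm (snd z))\<^sup>2 = Re (g (of_real ((norm (fst z))\<^sup>2)))"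
          define y where "y = arch_f CARD('k) (M - norm (fst z))"
          have y: "0 \<le> y" "y \<le> 1" "F y = M - norm (fst z)"
            using arch_f_bounds[OF k, of "M - norm (fst z)"] arch_integral_arch_f[OF k, of "M - norm (fst z)"] z \<epsilon>
            by (auto simp: y_def F_def M_def)
          then have "y\<^sup>2 = (norm (snd z))\<^sup>2" using g_eq[of y] z \<epsilon> eq by simp
          then have "norm (snd z) = y" using y by (simp add: power2_eq_iff_nonneg)
          then show "z \<in> ?S" using S[of z] y by auto
        qed
        then show ?thesis
          unfolding sum_Basis_remove[OF b(1)] inner_e Q_def by auto
      qed
      show "z + t *\<^sub>R e \<in> W" if "z \<in> W" for z t using that by (simp add: W_def e_def)
      show "Q (z + t *\<^sub>R e) = Q z" for z t
        by (simp add: Q_def e_def sum_inner_remove_invariant[OF b(1)])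
      have "continuous_on W (\<lambda>z. of_real ((norm (fst z))\<^sup>2) :: complex)" by (intro continuous_intros)
      moreover have "(\<lambda>z. of_real ((norm (fst z))\<^sup>2)) ` W \<subseteq> ball (0::complex) (\<epsilon>0\<^sup>2)"
        using in_ball by blast
      ultimately have "continuous_on W (\<lambda>z. g (of_real ((norm (fst z))\<^sup>2)))"
        by (rule continuous_on_compose2[OF holomorphic_on_imp_continuous_on[OF g]])
      then show "continuous_on W Q" unfolding Q_def by (intro continuous_intros)
      fix V assume V: "V \<subseteq> W" and pos: "\<And>v. v \<in> V \<Longrightarrow> Q v > 0"
      let ?B = "Basis - {e}"
      let ?C = "Pair 0 ` (Basis - {b}) :: ((real ^ 'm) \<times> (real ^ 'k)) set"
      let ?A = "(\<lambda>b. (b, 0)) ` Basis :: ((real ^ 'm) \<times> (real ^ 'k)) set"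
      interpret smooth_functions "P0 ?B V" ?B V by (rule smooth) auto
      have "?C \<subseteq> ?B" by (auto simp: Basis_prod_def e_def)
      then have C: "P0 ?B V (\<lambda>v. \<Sum>c\<in>?C. (v \<bullet> c)\<^sup>2)" by (intro sum_squares) auto
      have "?A \<subseteq> ?B" using b by (auto simp: Basis_prod_def e_def)
      then have "P0 ?B V (\<lambda>v. \<Sum>c\<in>?A. (v \<bullet> c)\<^sup>2)" by (intro sum_squares) auto
      then have A: "P0 ?B V (\<lambda>v. (norm (fst v))\<^sup>2)" unfolding fst_sq .
      have "P0 ?B V (\<lambda>v. Re (g (of_real ((norm (fst v))\<^sup>2))) - (\<Sum>c\<in>?C. (v \<bullet> c)\<^sup>2))"
        by (rule minus[OF holomorphic[OF A g open_ball in_ball] C]) (use V in auto)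
      then have "P0 ?B V Q" unfolding Q_def sum_sq_inner_Pair .
      then have "P0 ?B V (\<lambda>v. sgn (p \<bullet> e) * Re (csqrt (of_real (Q v))))"
        using pos by (rule signed_sqrt)
      then show "P ?B V (\<lambda>v. sgn (p \<bullet> e) * sqrt (Q v))"
        by (rule transfer[rotated]) (use pos in \<open>auto simp flip: of_real_sqrt simp: less_imp_le\<close>)
    qed
  qed
qed

theorem theorem2p5:
  fixes n k :: nat
  assumes "n \<ge> 3" and "2 \<le> k" and "k \<le> n - 1"
    and "CARD('k::finite) = k" and "CARD('m::finite) = n - k"
  shows "(even k \<longrightarrow>
           analytic_hypersurface (arch_spherical_array :: ((real ^ 'm) \<times> (real ^ 'k)) set)) \<and>
         (odd k \<longrightarrow>
           C_diff_hypersurface (k - 1) (arch_spherical_array :: ((real ^ 'm) \<times> (real ^ 'k)) set))"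
proof (intro conjI impI)
  have k: "CARD('k) \<ge> 2" using assms by simp
  {
    assume "even k"
    then obtain K where K: "K holomorphic_on ball 0 1"
        "\<And>y. 0 \<le> y \<Longrightarrow> y < 1 \<Longrightarrow> arch_integral k y = Re (K (of_real (y\<^sup>2)))"
      by (rule arch_integral_even[OF assms(2)]) (rule that)
    show "analytic_hypersurface (arch_spherical_array :: ((real ^ 'm) \<times> (real ^ 'k)) set)"
      unfolding analytic_hypersurface_def
    proof (rule locally_graph_arch_spherical_array[OF k, where
          ?P0.0 = "\<lambda>B V g. \<forall>a\<in>V. analytic_at_point B a g"])
      fix B V :: "((real ^ 'm) \<times> (real ^ 'k)) set" assume "B \<subseteq> Basis"
      then have B: "finite B" by (rule finite_subset) simp
      show sf: "smooth_functions (\<lambda>g. \<forall>a\<in>V. analytic_at_point B a g) B V"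
        by (rule smooth_functions_analytic[OF B])
      show "real_analytic_on B V g"
        if "\<forall>a\<in>V. analytic_at_point B a f" "\<And>v. v \<in> V \<Longrightarrow> f v = g v" for f g
        using real_analytic_onI[OF B \<open>B \<subseteq> Basis\<close>, of V f] that by (simp add: real_analytic_on_def)
      assume 1: "Pair 0 ` Basis \<subseteq> B" and V: "V \<subseteq> {v. norm (snd v) < 1}"
      interpret smooth_functions "\<lambda>g. \<forall>a\<in>V. analytic_at_point B a g" B V by (rule sf)
      have "\<forall>a\<in>V. analytic_at_point B a (\<lambda>v. \<Sum>c\<in>Pair 0 ` Basis. (v \<bullet> c)\<^sup>2)"
        using 1 by (intro sum_squares) auto
      then have 2: "\<forall>a\<in>V. analytic_at_point B a (\<lambda>v. (norm (snd v))\<^sup>2)"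
        by (simp add: sum_sq_inner_Pair norm_sq_eq_sum_inner)
      have "\<forall>a\<in>V. analytic_at_point B a (\<lambda>v. Re (K (of_real ((norm (snd v))\<^sup>2))))"
        by (rule holomorphic[OF 2 K(1) open_ball])
           (use V in \<open>auto simp: norm_power power_less_one_iff\<close>)
      moreover have "\<forall>v\<in>V. Re (K (of_real ((norm (snd v))\<^sup>2))) = arch_integral CARD('k) (norm (snd v))"
        using K(2) V assms(4) by auto
      ultimately show "\<exists>\<Phi>. (\<forall>a\<in>V. analytic_at_point B a \<Phi>) \<and>
          (\<forall>v\<in>V. \<Phi> v = arch_integral CARD('k) (norm (snd v)))"
        by (intro exI[of _ "\<lambda>v. Re (K (of_real ((norm (snd v))\<^sup>2)))"] conjI)
    qed
  }
  show "C_diff_hypersurface (k - 1) (arch_spherical_array :: ((real ^ 'm) \<times> (real ^ 'k)) set)"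
    unfolding C_diff_hypersurface_def
  proof (rule locally_graph_arch_spherical_array[OF k, where ?P0.0 = "\<lambda>B V. C_diff_on B (k - 1) V"])
    fix B V :: "((real ^ 'm) \<times> (real ^ 'k)) set"
    show "smooth_functions (C_diff_on B (k - 1) V) B V" by (rule smooth_functions_C_diff)
    show "C_diff_on B (k - 1) V g" if "C_diff_on B (k - 1) V f" "\<And>v. v \<in> V \<Longrightarrow> f v = g v" for f g
      using C_diff_on_cong[of V f g] that by blast
    assume "Pair 0 ` Basis \<subseteq> B" "V \<subseteq> {v. norm (snd v) < 1}"
    then have "C_diff_on B (k - 1) V (\<lambda>v. arch_integral CARD('k) (norm (snd v)))"
      using C_diff_on_arch_integral_norm[OF k] assms(4) by simp
    then show "\<exists>\<Phi>. C_diff_on B (k - 1) V \<Phi> \<and> (\<forall>v\<in>V. \<Phi> v = arch_integral CARD('k) (norm (snd v)))"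
      by blast
  qed
qed

end
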